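(* For any bounded Ahlfors regular $1$-set $E \subseteq \mathbb{R}^2$, there exists a Lipschitz image $I$, i.e. a set $I = g([0,1])$ for some Lipschitz function $g:[0,1]\to\mathbb{R}^2$, such that $\dim(E \cap I) = 1$.
   Context: $\dim$ denotes Hausdorff dimension and $\mathcal{H}^1$ the $1$-dimensional Hausdorff measure. A $1$-set is a set $E\subseteq\mathbb{R}^2$ with $\dim(E)=1$ and $0<\mathcal{H}^1(E)<\infty$. A $1$-set $E$ is Ahlfors regular if there exist constants $a,b>0$ such that $a r\le\mathcal{H}^1(E\cap B(x,r))\le b r$ for all $x\in E$ and all $r\in(0,\operatorname{diam}(E))$, where $B(x,r)$ is the closed ball.
   Formalization: The 1-set E is additionally assumed to be H^1-measurable (the usual convention for s-sets); for arbitrary sets with H^1 read as outer measure, the claim fails under the continuum hypothesis. *)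

theory Defs
  imports "HOL-Analysis.Analysis"
begin

(* The summand |U|^s. Since 0 powr 0 = 0 in HOL, the case s = 0 is separate: it makes the
   0-dimensional measure the counting measure. The empty set, with which finite covers are
   padded to sequences, always counts 0. *)
definition diam_pow :: "real \<Rightarrow> 'a::metric_space set \<Rightarrow> ennreal" where
  "diam_pow s U =
     (if U = {} then 0 else if s = 0 then 1 else ennreal (diameter U powr s))"

(* Boundedness is required because the library gives an unbounded set an unspecified real
   diameter. *)
definition delta_covers :: "real \<Rightarrow> 'a::metric_space set \<Rightarrow> (nat \<Rightarrow> 'a set) set" where
  "delta_covers \<delta> E =
     {U. E \<subseteq> (\<Union>i. U i) \<and> (\<forall>i. bounded (U i) \<and> diameter (U i) \<le> \<delta>)}"

definition hausdorff_content :: "real \<Rightarrow> real \<Rightarrow> 'a::metric_space set \<Rightarrow> ennreal" where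
  "hausdorff_content s \<delta> E = (INF U\<in>delta_covers \<delta> E. \<Sum>i. diam_pow s (U i))"

(* H^s, as an outer measure on all subsets. It is normalised so that H^1 of a line segment is
   its length. *)
definition hausdorff_measure :: "real \<Rightarrow> 'a::metric_space set \<Rightarrow> ennreal" where
  "hausdorff_measure s E = (SUP \<delta>\<in>{0<..}. hausdorff_content s \<delta> E)"

(* H^s-measurable in the sense of Caratheodory. *)
definition hausdorff_measurable :: "real \<Rightarrow> 'a::metric_space set \<Rightarrow> bool" where
  "hausdorff_measurable s E \<longleftrightarrow> E \<in> lambda_system UNIV UNIV (hausdorff_measure s)"

definition hausdorff_dim :: "'a::metric_space set \<Rightarrow> ennreal" where
  "hausdorff_dim E = Inf {ennreal s | s. 0 \<le> s \<and> hausdorff_measure s E = 0}"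

(* Measurability is part of speaking of the measure H^1(E). It is needed: under the continuum
   hypothesis a purely unrectifiable self-similar 1-set contains a Sierpinski-type subset of
   full outer measure in every ball that meets every Lipschitz curve in a countable set. *)
definition one_set :: "(real^2) set \<Rightarrow> bool" where
  "one_set E \<longleftrightarrow>
     hausdorff_measurable 1 E \<and> hausdorff_dim E = 1 \<and>
     0 < hausdorff_measure 1 E \<and> hausdorff_measure 1 E < \<infinity>"

(* An unbounded set has infinite diameter, so that r is then unrestricted. *)
definition ahlfors_regular :: "(real^2) set \<Rightarrow> bool" where
  "ahlfors_regular E \<longleftrightarrow>
     (\<exists>a>0. \<exists>b>0. \<forall>x\<in>E. \<forall>r>0. (bounded E \<longrightarrow> r < diameter E) \<longrightarrow>
        ennreal (a * r) \<le> hausdorff_measure 1 (E \<inter> cball x r) \<and>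
        hausdorff_measure 1 (E \<inter> cball x r) \<le> ennreal (b * r))"

definition lipschitz_image :: "(real^2) set \<Rightarrow> bool" where
  "lipschitz_image I \<longleftrightarrow>
     (\<exists>(g :: real \<Rightarrow> real^2) L. L-lipschitz_on {0..1} g \<and> I = g ` {0..1})"

end

theory Submission
  imports Defs "HOL-Real_Asymp.Real_Asymp"
begin

text \<open>
  The set \<open>E\<close> may be purely unrectifiable. Every curve of finite length then meets it in length
  zero, and one that meets it in dimension \<open>1\<close> has to be steered through a Cantor set in \<open>E\<close>. The
  Cantor set is the limit of a tree of balls centred in \<open>E\<close>. A ball of generation \<open>k\<close> has radius
  \<open>r k\<close> and \<open>m k = 2 ^ (k ^ 2)\<close> children in the next generation, whose centres lie in it and are at
  least \<open>4 * r (Suc k)\<close> apart. Let \<open>N k\<close> be the number of balls of generation \<open>k\<close>, so that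
  \<open>N (Suc k) = N k * m k\<close>. Two conditions on the radii pull against each other.

  \<^item> A curve that visits all balls of generation \<open>k + 1\<close>, parent by parent, makes at most
    \<open>N (Suc k)\<close> jumps within the parents, of length at most a multiple of \<open>r k\<close>. If
    \<open>r k * N (Suc k)\<close> is summable, the total length is finite (\<open>lipschitz_image_through_tree\<close>).
  \<^item> Number the balls of each generation from left to right by the intervals of length \<open>1 / N k\<close> in
    \<open>[0,1)\<close>. If \<open>1 / N k \<le> C * r (Suc k) powr s\<close>, the map from a point of the Cantor set to its
    address in \<open>[0,1)\<close> is \<open>s\<close>-Hoelder, and its image has length \<open>1\<close>, so the Cantor set has positive
    \<open>s\<close>-dimensional measure (\<open>hausdorff_measure_pos_if_holder_inverse\<close>). This is wanted for all
    \<open>s < 1\<close> at once.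

  Ahlfors regularity provides such a tree (\<open>dense_point_tree\<close>). As \<open>E\<close> need not be closed, the centres
  are taken in a compact set \<open>K \<subseteq> E\<close> of positive measure, which exists because \<open>E\<close> is measurable
  (\<open>compact_subset_of_positive_measure\<close>). The set \<open>K\<close> need not be regular: in a ball of radius \<open>r\<close> it
  may have mass \<open>\<tau> * r\<close> only. But at scale \<open>\<rho> * r\<close> the set \<open>E\<close> has at most a constant times \<open>1 / \<rho>\<close>
  separated points in the ball, so most of the mass of \<open>K\<close> lies in balls of radius \<open>\<rho> * r\<close> and mass at
  least \<open>\<tau> / \<Lambda> * (\<rho> * r)\<close>, where \<open>\<Lambda>\<close> depends only on the regularity constants of \<open>E\<close>. By upper
  regularity there are at least a constant times \<open>\<tau> / \<rho>\<close> of these balls. Hence the density bound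
  degrades by the constant factor \<open>\<Lambda>\<close> per generation, \<open>r k * N k\<close> decays like \<open>\<Lambda> powr (- k^2 / 2)\<close>
  up to a geometric factor, and \<open>N k\<close> grows like \<open>2 powr (k^3 / 3)\<close> up to lower order terms in the
  exponent. The square in the exponent of \<open>m k\<close> is small enough for the length, since \<open>\<Lambda> \<ge> 16\<close>, and
  large enough for the dimension, since \<open>k^3\<close> dominates \<open>k^2\<close> (\<open>tree_scales\<close>).
\<close>

section \<open>Hausdorff measures as metric outer measures\<close>

lemma hausdorff_content_le_measure:
  "0 < \<delta> \<Longrightarrow> hausdorff_content s \<delta> A \<le> hausdorff_measure s A"
  unfolding hausdorff_measure_def by (rule SUP_upper) auto

lemma hausdorff_content_mono:
  "A \<subseteq> B \<Longrightarrow> hausdorff_content s \<delta> A \<le> hausdorff_content s \<delta> B"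
  unfolding hausdorff_content_def delta_covers_def by (rule INF_superset_mono) auto

lemma hausdorff_content_antimono:
  "\<delta> \<le> \<epsilon> \<Longrightarrow> hausdorff_content s \<epsilon> A \<le> hausdorff_content s \<delta> A"
  unfolding hausdorff_content_def delta_covers_def
  by (rule INF_superset_mono) (blast intro: order_trans, simp)

lemma hausdorff_measure_mono:
  "A \<subseteq> B \<Longrightarrow> hausdorff_measure s A \<le> hausdorff_measure s B"
  unfolding hausdorff_measure_def by (rule SUP_mono') (rule hausdorff_content_mono)

lemma hausdorff_measure_empty: "hausdorff_measure s {} = 0"
proof -
  have "hausdorff_content s \<delta> ({}::'a set) \<le> 0" if "\<delta> > 0" for \<delta>
    unfolding hausdorff_content_def
    by (rule INF_lower2[of "\<lambda>_. {}"]) (use that in \<open>auto simp: delta_covers_def diam_pow_def\<close>)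
  then show ?thesis unfolding hausdorff_measure_def by simp
qed

lemma near_optimal_cover:
  assumes "hausdorff_content s \<delta> A < \<infinity>" and "0 < (e::real)"
  obtains U where "U \<in> delta_covers \<delta> A" "(\<Sum>i. diam_pow s (U i)) \<le> hausdorff_content s \<delta> A + ennreal e"
proof -
  have "hausdorff_content s \<delta> A < hausdorff_content s \<delta> A + ennreal e"
    using assms by (simp add: ennreal_less_zero_iff ennreal_zero_less_top)
  then show ?thesis
    using that unfolding hausdorff_content_def INF_less_iff by (meson less_imp_le)
qed

text \<open>
  Covers of the \<open>A i\<close> that exceed the optimum by at most \<open>e / 2 ^ Suc i\<close> merge, through a pairing
  function, into a single cover of the union.
\<close>

lemma hausdorff_content_UN_le:
  "hausdorff_content s \<delta> (\<Union>i. A i) \<le> (\<Sum>i. hausdorff_content s \<delta> (A i))"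
proof (cases "(\<Sum>i. hausdorff_content s \<delta> (A i)) = \<infinity>")
  case False
  then have fin: "hausdorff_content s \<delta> (A i) < \<infinity>" for i
    using ennreal_suminf_lessD[of "\<lambda>i. hausdorff_content s \<delta> (A i)" \<infinity> i] by (simp add: top.not_eq_extremum)
  show ?thesis
  proof (rule ennreal_le_epsilon)
    fix e :: real assume e: "0 < e"
    have "\<exists>V. V \<in> delta_covers \<delta> (A i) \<and>
        (\<Sum>j. diam_pow s (V j)) \<le> hausdorff_content s \<delta> (A i) + ennreal (e * (1/2)^Suc i)" for i
      using near_optimal_cover[OF fin[of i], of "e * (1/2)^Suc i"] e
      by (metis mult_pos_pos half_gt_zero_iff zero_less_one zero_less_power)
    then obtain V where V: "\<And>i. V i \<in> delta_covers \<delta> (A i)"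
      "\<And>i. (\<Sum>j. diam_pow s (V i j)) \<le> hausdorff_content s \<delta> (A i) + ennreal (e * (1/2)^Suc i)"
      by metis
    define W where "W n = (case prod_decode n of (i, j) \<Rightarrow> V i j)" for n
    have "W \<in> delta_covers \<delta> (\<Union>i. A i)"
    proof -
      have "\<exists>n. x \<in> W n" if x: "x \<in> A i" for x i
      proof -
        obtain j where "x \<in> V i j" using V(1)[of i] x unfolding delta_covers_def by blast
        then have "x \<in> W (prod_encode (i, j))" unfolding W_def by simp
        then show ?thesis by blast
      qed
      then show ?thesis
        using V(1) unfolding delta_covers_def W_def by (auto split: prod.splits)
    qed
    then have "hausdorff_content s \<delta> (\<Union>i. A i) \<le> (\<Sum>n. diam_pow s (W n))"
      unfolding hausdorff_content_def by (rule INF_lower)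
    also have "\<dots> = (\<Sum>i. \<Sum>j. diam_pow s (V i j))"
    proof -
      have "(\<lambda>n. diam_pow s (W n)) = (\<lambda>(i, j). diam_pow s (V i j)) \<circ> prod_decode"
        by (auto simp: W_def split: prod.splits)
      then show ?thesis
        using suminf_ennreal_2dimen[of "\<lambda>i. \<Sum>j. diam_pow s (V i j)" "\<lambda>(i, j). diam_pow s (V i j)"]
        by (simp add: comp_def)
    qed
    also have "\<dots> \<le> (\<Sum>i. hausdorff_content s \<delta> (A i) + ennreal (e * (1/2)^Suc i))"
      by (intro suminf_le V(2)) auto
    also have "\<dots> = (\<Sum>i. hausdorff_content s \<delta> (A i)) + (\<Sum>i. ennreal (e * (1/2)^Suc i))"
      by (rule suminf_add[symmetric]) auto
    also have "(\<Sum>i. ennreal (e * (1/2)^Suc i)) = ennreal e"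
    proof (rule suminf_ennreal_eq)
      show "(\<lambda>i. e * (1/2)^Suc i) sums e"
        using sums_mult[OF power_half_series, of e] by simp
    qed (use e in auto)
    finally show "hausdorff_content s \<delta> (\<Union>i. A i) \<le> (\<Sum>i. hausdorff_content s \<delta> (A i)) + ennreal e" .
  qed
qed simp

lemma hausdorff_measure_UN_le:
  "hausdorff_measure s (\<Union>i::nat. A i) \<le> (\<Sum>i. hausdorff_measure s (A i))"
  unfolding hausdorff_measure_def[of s "\<Union>i. A i"]
  by (intro SUP_least order_trans[OF hausdorff_content_UN_le] suminf_le hausdorff_content_le_measure) auto

lemma hausdorff_outer_measure_space:
  "outer_measure_space UNIV (hausdorff_measure s)"
  unfolding outer_measure_space_def positive_def increasing_def countably_subadditive_def
  by (auto intro: hausdorff_measure_mono hausdorff_measure_UN_le hausdorff_measure_empty)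

lemma hausdorff_measure_Un_le:
  "hausdorff_measure s (A \<union> B) \<le> hausdorff_measure s A + hausdorff_measure s B"
proof -
  let ?F = "\<lambda>i::nat. if i = 0 then A else if i = 1 then B else {}"
  have "hausdorff_measure s (\<Union>i. ?F i) \<le> (\<Sum>i. hausdorff_measure s (?F i))"
    by (rule hausdorff_measure_UN_le)
  also have "(\<Sum>i. hausdorff_measure s (?F i)) = (\<Sum>i\<in>{0,1}. hausdorff_measure s (?F i))"
    by (rule suminf_finite) (auto simp: hausdorff_measure_empty)
  also have "(\<Union>i. ?F i) = A \<union> B" by (auto split: if_splits)
  finally show ?thesis by simp
qed

text \<open>
  A set of diameter less than \<open>d\<close> meets at most one of \<open>A\<close> and \<open>B\<close>, so a fine cover of the union
  splits into a cover of \<open>A\<close> and a cover of \<open>B\<close>. With this, \<open>H^s\<close> is a metric outer measure.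
\<close>

lemma hausdorff_measure_separated:
  assumes "0 < d" and sep: "\<And>x y. x \<in> A \<Longrightarrow> y \<in> B \<Longrightarrow> d \<le> dist x y"
  shows "hausdorff_measure s A + hausdorff_measure s B \<le> hausdorff_measure s (A \<union> B)"
proof -
  have main: "hausdorff_content s \<delta> A + hausdorff_content s \<delta> B \<le> hausdorff_content s \<delta> (A \<union> B)"
    if \<delta>: "0 < \<delta>" "\<delta> < d" for \<delta>
    unfolding hausdorff_content_def[of s \<delta> "A \<union> B"]
  proof (rule INF_greatest)
    fix U assume U: "U \<in> delta_covers \<delta> (A \<union> B)"
    define V where "V i = (if U i \<inter> A = {} then {} else U i)" for i
    define W where "W i = (if U i \<inter> B = {} then {} else U i)" for i
    have V: "V \<in> delta_covers \<delta> A" and W: "W \<in> delta_covers \<delta> B"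
      using U \<delta> by (auto simp: delta_covers_def V_def W_def; blast)+
    have one: "diam_pow s (V i) + diam_pow s (W i) \<le> diam_pow s (U i)" for i
    proof (cases "U i \<inter> A = {} \<or> U i \<inter> B = {}")
      case True then show ?thesis unfolding V_def W_def by (auto simp: diam_pow_def)
    next
      case False
      then obtain x y where "x \<in> U i" "x \<in> A" "y \<in> U i" "y \<in> B" by blast
      moreover have "bounded (U i)" "diameter (U i) \<le> \<delta>" using U by (auto simp: delta_covers_def)
      ultimately have "d \<le> \<delta>"
        using diameter_bounded_bound[of "U i" x y] sep[of x y] by auto
      with \<delta> show ?thesis by simp
    qed
    have "hausdorff_content s \<delta> A + hausdorff_content s \<delta> B
        \<le> (\<Sum>i. diam_pow s (V i)) + (\<Sum>i. diam_pow s (W i))"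
      unfolding hausdorff_content_def using V W by (intro add_mono INF_lower)
    also have "\<dots> = (\<Sum>i. diam_pow s (V i) + diam_pow s (W i))"
      by (rule suminf_add) auto
    also have "\<dots> \<le> (\<Sum>i. diam_pow s (U i))"
      by (intro suminf_le one) auto
    finally show "hausdorff_content s \<delta> A + hausdorff_content s \<delta> B \<le> (\<Sum>i. diam_pow s (U i))" .
  qed
  have le: "hausdorff_content s \<delta> A + hausdorff_content s \<epsilon> B \<le> hausdorff_measure s (A \<union> B)"
    if "0 < \<delta>" "0 < \<epsilon>" for \<delta> \<epsilon>
  proof -
    let ?m = "min (min \<delta> \<epsilon>) (d/2)"
    have "hausdorff_content s \<delta> A + hausdorff_content s \<epsilon> B
        \<le> hausdorff_content s ?m A + hausdorff_content s ?m B"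
      by (intro add_mono hausdorff_content_antimono) auto
    also have "\<dots> \<le> hausdorff_content s ?m (A \<union> B)" by (rule main) (use that assms(1) in auto)
    also have "\<dots> \<le> hausdorff_measure s (A \<union> B)"
      by (rule hausdorff_content_le_measure) (use that assms(1) in auto)
    finally show ?thesis .
  qed
  have "hausdorff_content s \<delta> A + hausdorff_measure s B \<le> hausdorff_measure s (A \<union> B)" if "0 < \<delta>" for \<delta>
    unfolding hausdorff_measure_def[of s B]
    by (subst ennreal_SUP_add_right) (use that in \<open>auto intro!: SUP_least le\<close>)
  then show ?thesis
    unfolding hausdorff_measure_def[of s A]
    by (subst ennreal_SUP_add_left[symmetric]) (auto intro!: SUP_least)
qed

text \<open>
  Caratheodory's criterion. The part of \<open>T\<close> at distance at least \<open>1 / Suc n\<close> from \<open>C\<close> is separated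
  from \<open>T \<inter> C\<close>, so the two add up. What is left of \<open>T - C\<close> consists of thin layers around \<open>C\<close>. Every
  second layer is separated from the others of its parity, which makes the measures of all layers
  summable, and their tail vanishes as \<open>n\<close> grows.
\<close>

lemma closed_hausdorff_measurable:
  assumes "closed C"
  shows "hausdorff_measurable s C"
proof -
  let ?H = "hausdorff_measure s"
  have main: "?H (T \<inter> C) + ?H (T - C) \<le> ?H T" if fin: "?H T < \<infinity>" and "C \<noteq> {}" for T
  proof -
    define S where "S n = {x\<in>T. 1 / real (Suc n) \<le> infdist x C}" for n
    define D where "D n = S (Suc n) - S n" for n
    have S_mono: "S m \<subseteq> S n" if "m \<le> n" for m n
    proof
      fix x assume "x \<in> S m"
      moreover have "1 / real (Suc n) \<le> 1 / real (Suc m)" using that by (simp add: frac_le)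
      ultimately show "x \<in> S n" unfolding S_def by auto
    qed
    have gap: "1 / real (Suc n) - 1 / real (Suc (Suc n)) \<le> dist x y"
      if "x \<in> S n" "infdist y C \<le> 1 / real (Suc (Suc n))" for n x y
      using that infdist_triangle[of x C y] unfolding S_def by auto
    have gap_pos: "0 < 1 / real (Suc n) - 1 / real (Suc (Suc n))" for n
      by (simp add: frac_less2)
    have step: "?H A + ?H B \<le> ?H T"
      if "A \<subseteq> S n" "B \<subseteq> T" "\<And>y. y \<in> B \<Longrightarrow> infdist y C \<le> 1 / real (Suc (Suc n))" for A B n
    proof -
      have "?H A + ?H B \<le> ?H (A \<union> B)"
        by (rule hausdorff_measure_separated[OF gap_pos[of n]]) (use that gap in blast)
      also have "\<dots> \<le> ?H T"
        by (rule hausdorff_measure_mono) (use that in \<open>auto simp: S_def\<close>)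
      finally show ?thesis .
    qed
    have alternate: "(\<Sum>i<k. ?H (D (2 * i + p))) \<le> ?H (\<Union>i<k. D (2 * i + p))" for k p
    proof (induction k)
      case (Suc k)
      show ?case
      proof (cases k)
        case (Suc j)
        have "?H (\<Union>i<k. D (2 * i + p)) + ?H (D (2 * k + p))
            \<le> ?H ((\<Union>i<k. D (2 * i + p)) \<union> D (2 * k + p))"
        proof (rule hausdorff_measure_separated[OF gap_pos[of "2 * j + p + 1"]])
          fix x y assume x: "x \<in> (\<Union>i<k. D (2 * i + p))" and y: "y \<in> D (2 * k + p)"
          from x obtain i where "i < k" "x \<in> S (Suc (2 * i + p))" unfolding D_def by blast
          then have "x \<in> S (2 * j + p + 1)"
            using S_mono[of "Suc (2 * i + p)" "2 * j + p + 1"] Suc by auto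
          moreover from y have "infdist y C \<le> 1 / real (Suc (2 * k + p))"
            unfolding D_def S_def by auto
          ultimately show "1 / real (Suc (2 * j + p + 1)) - 1 / real (Suc (Suc (2 * j + p + 1))) \<le> dist x y"
            using gap[of x "2 * j + p + 1" y] Suc by auto
        qed
        moreover have "(\<Union>i<Suc k. D (2 * i + p)) = (\<Union>i<k. D (2 * i + p)) \<union> D (2 * k + p)"
          by (auto simp: less_Suc_eq)
        ultimately show ?thesis
          using order_trans[OF add_right_mono[OF Suc.IH, of "?H (D (2 * k + p))"]]
          unfolding sum.lessThan_Suc by simp
      qed (simp add: lessThan_Suc)
    qed (simp add: hausdorff_measure_empty)
    have "(\<Sum>i<n. ?H (D i)) \<le> ?H T + ?H T" for n
    proof -
      have "(\<Sum>i<n. ?H (D i)) \<le> (\<Sum>i<2*n. ?H (D i))" by (rule sum_mono2) auto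
      also have "\<dots> = (\<Sum>i<n. ?H (D (2*i+0))) + (\<Sum>i<n. ?H (D (2*i+1)))"
        by (induction n) (simp_all add: algebra_simps)
      also have "\<dots> \<le> ?H T + ?H T"
        by (intro add_mono order_trans[OF alternate] hausdorff_measure_mono) (auto simp: D_def S_def)
      finally show ?thesis .
    qed
    then have "(\<Sum>i. ?H (D i)) \<le> ?H T + ?H T"
      by (rule suminf_le_const[OF summableI])
    also have "\<dots> < \<infinity>" using fin by simp
    finally have sum_fin: "(\<Sum>i. ?H (D i)) \<noteq> \<infinity>" by simp
    define f where "f i = enn2real (?H (D i))" for i
    have f: "?H (D i) = ennreal (f i)" for i
    proof -
      have "?H (D i) \<le> ?H T" by (rule hausdorff_measure_mono) (auto simp: D_def S_def)
      from this fin have "?H (D i) < \<infinity>" by (rule le_less_trans)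
      then show ?thesis unfolding f_def by simp
    qed
    have "summable f"
      using sum_fin unfolding f by (intro summable_suminf_not_top) (auto simp: f_def)
    show ?thesis
    proof (rule ennreal_le_epsilon)
      fix e :: real assume "0 < e"
      then obtain n where n: "norm (\<Sum>i. f (i + n)) < e"
        using suminf_exist_split[OF _ \<open>summable f\<close>] by blast
      have cover: "T - C \<subseteq> S n \<union> (\<Union>i. D (i + n))"
      proof
        fix x assume x: "x \<in> T - C"
        then have "0 < infdist x C"
          using assms \<open>C \<noteq> {}\<close> by (simp add: infdist_pos_not_in_closed)
        then obtain m where "1 / real (Suc m) < infdist x C"
          by (metis nat_approx_posE)
        then have ex: "x \<in> S (n + m)"
          using x S_mono[of m "n + m"] unfolding S_def by auto
        show "x \<in> S n \<union> (\<Union>i. D (i + n))"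
          using ex
        proof (induction m)
          case (Suc m)
          then show ?case unfolding D_def by (auto simp: add.commute)
        qed simp
      qed
      have "?H (T - C) \<le> ?H (S n) + (\<Sum>i. ?H (D (i + n)))"
        by (rule order_trans[OF hausdorff_measure_mono[OF cover]])
           (intro order_trans[OF hausdorff_measure_Un_le] add_left_mono hausdorff_measure_UN_le)
      also have "(\<Sum>i. ?H (D (i + n))) = ennreal (\<Sum>i. f (i + n))"
        unfolding f
        by (intro suminf_ennreal2 summable_ignore_initial_segment \<open>summable f\<close>) (simp add: f_def)
      also have "\<dots> \<le> ennreal e" using n by (intro ennreal_leI) auto
      finally have "?H (T - C) \<le> ?H (S n) + ennreal e" by (simp add: add_left_mono)
      moreover have "?H (S n) + ?H (T \<inter> C) \<le> ?H T"
        by (rule step[of _ n]) auto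
      ultimately have "?H (T \<inter> C) + ?H (T - C) \<le> ?H (T \<inter> C) + (?H (S n) + ennreal e)"
        by (intro add_left_mono)
      also have "\<dots> = (?H (S n) + ?H (T \<inter> C)) + ennreal e" by (simp add: algebra_simps)
      also have "\<dots> \<le> ?H T + ennreal e" by (rule add_right_mono) fact
      finally show "?H (T \<inter> C) + ?H (T - C) \<le> ?H T + ennreal e" .
    qed
  qed
  have "?H (C \<inter> T) + ?H ((UNIV - C) \<inter> T) = ?H T" for T
  proof (rule antisym)
    have "(UNIV - C) \<inter> T = T - C" by auto
    then show "?H (C \<inter> T) + ?H ((UNIV - C) \<inter> T) \<le> ?H T"
      using main[of T] by (cases "C = {}"; cases "?H T = \<infinity>")
        (auto simp: hausdorff_measure_empty Int_commute less_top)
    have "T = (C \<inter> T) \<union> ((UNIV - C) \<inter> T)" by auto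
    then show "?H T \<le> ?H (C \<inter> T) + ?H ((UNIV - C) \<inter> T)"
      by (metis hausdorff_measure_Un_le)
  qed
  then show ?thesis unfolding hausdorff_measurable_def lambda_system_def by auto
qed

section \<open>Borel sets and compact subsets of positive measure\<close>

text \<open>
  The Caratheodory measurable sets form a sigma algebra, and it contains the closed sets.
\<close>

lemma borel_hausdorff_measurable:
  fixes A :: "'a::metric_space set"
  assumes "A \<in> sets borel"
  shows "hausdorff_measurable s A"
proof -
  interpret U: sigma_algebra UNIV "UNIV :: 'a set set"
    using sigma_algebra_Pow[of "UNIV :: 'a set"] by simp
  have "measure_space UNIV (lambda_system UNIV UNIV (hausdorff_measure s)) (hausdorff_measure s :: 'a set \<Rightarrow> _)"
    by (rule U.caratheodory_lemma) (rule hausdorff_outer_measure_space)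
  then interpret L: sigma_algebra UNIV "lambda_system UNIV UNIV (hausdorff_measure s :: 'a set \<Rightarrow> _)"
    by (simp add: measure_space_def)
  have "sigma_sets UNIV (Collect closed) \<subseteq> lambda_system UNIV UNIV (hausdorff_measure s :: 'a set \<Rightarrow> _)"
    by (rule L.sigma_sets_subset) (use closed_hausdorff_measurable in \<open>auto simp: hausdorff_measurable_def\<close>)
  moreover have "A \<in> sigma_sets UNIV (Collect closed)"
    using assms unfolding borel_eq_closed by simp
  ultimately show ?thesis unfolding hausdorff_measurable_def by blast
qed

lemma hausdorff_measurable_split:
  assumes "hausdorff_measurable s E"
  shows "hausdorff_measure s A = hausdorff_measure s (A \<inter> E) + hausdorff_measure s (A - E)"
proof -
  have "hausdorff_measure s (E \<inter> A) + hausdorff_measure s ((UNIV - E) \<inter> A) = hausdorff_measure s A"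
    using assms unfolding hausdorff_measurable_def lambda_system_def by blast
  moreover have "(UNIV - E) \<inter> A = A - E" by auto
  ultimately show ?thesis by (simp add: Int_commute)
qed

text \<open>
  The domain is the Borel sets rather than all Caratheodory measurable sets, as regularity of finite
  measures on complete separable spaces is a statement about Borel measures.
\<close>

definition hausdorff_on :: "real \<Rightarrow> 'a::metric_space set \<Rightarrow> 'a measure" where
  "hausdorff_on s E = measure_of UNIV (sets borel) (\<lambda>A. hausdorff_measure s (E \<inter> A))"

lemma sets_hausdorff_on: "sets (hausdorff_on s E) = sets borel"
  unfolding hausdorff_on_def using sigma_algebra.sets_measure_of_eq[OF sets.sigma_algebra_axioms[of borel]]
  by simp

lemma emeasure_hausdorff_on:
  fixes E :: "'a::metric_space set"
  assumes E: "hausdorff_measurable s E" and A: "A \<in> sets borel"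
  shows "emeasure (hausdorff_on s E) A = hausdorff_measure s (E \<inter> A)"
  unfolding hausdorff_on_def
proof (rule emeasure_measure_of_sigma[OF _ _ _ A])
  show "sigma_algebra UNIV (sets (borel :: 'a measure))"
    using sets.sigma_algebra_axioms[of "borel :: 'a measure"] by simp
  show "positive (sets borel) (\<lambda>A. hausdorff_measure s (E \<inter> A))"
    by (simp add: positive_def hausdorff_measure_empty)
  interpret U: sigma_algebra UNIV "UNIV :: 'a set set"
    using sigma_algebra_Pow[of "UNIV :: 'a set"] by simp
  let ?L = "lambda_system UNIV UNIV (hausdorff_measure s :: 'a set \<Rightarrow> _)"
  have ms: "measure_space UNIV ?L (hausdorff_measure s)"
    by (rule U.caratheodory_lemma) (rule hausdorff_outer_measure_space)
  then interpret L: sigma_algebra UNIV ?L by (simp add: measure_space_def)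
  have ca: "countably_additive ?L (hausdorff_measure s)" using ms by (simp add: measure_space_def)
  show "countably_additive (sets borel) (\<lambda>A. hausdorff_measure s (E \<inter> A))"
    unfolding countably_additive_def
  proof (intro allI impI)
    fix F :: "nat \<Rightarrow> 'a set" assume F: "range F \<subseteq> sets borel" "disjoint_family F"
    have "E \<inter> F i \<in> ?L" for i
      using E borel_hausdorff_measurable[of "F i" s] F(1) unfolding hausdorff_measurable_def by auto
    then have in_L: "range (\<lambda>i. E \<inter> F i) \<subseteq> ?L" by blast
    moreover have "disjoint_family (\<lambda>i. E \<inter> F i)" using F(2) unfolding disjoint_family_on_def by blast
    ultimately have "(\<Sum>i. hausdorff_measure s (E \<inter> F i)) = hausdorff_measure s (\<Union>i. E \<inter> F i)"
      using ca[unfolded countably_additive_def, rule_format, OF in_L] L.countable_UN[OF in_L] by blast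
    then show "(\<Sum>i. hausdorff_measure s (E \<inter> F i)) = hausdorff_measure s (E \<inter> (\<Union>i. F i))"
      by (simp only: Int_UN_distrib)
  qed
qed

lemma diam_pow_closure:
  assumes "bounded U" shows "diam_pow s (closure U) = diam_pow s U"
  unfolding diam_pow_def using diameter_closure[OF assms] by simp

text \<open>
  A set and its closure have the same diameter, so almost optimal covers may be taken to consist of
  closed sets. The hull is the set that all of countably many such covers, with mesh and error
  tending to \<open>0\<close>, have in common.
\<close>

lemma borel_hull:
  fixes A :: "'a::metric_space set"
  assumes "hausdorff_measure s A < \<infinity>"
  obtains B where "B \<in> sets borel" "A \<subseteq> B" "hausdorff_measure s B = hausdorff_measure s A"
proof -
  have cont: "hausdorff_content s (1 / Suc n) A \<le> hausdorff_measure s A" for n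
    by (rule hausdorff_content_le_measure) simp
  have "\<exists>U. U \<in> delta_covers (1 / Suc n) A \<and>
      (\<Sum>i. diam_pow s (U i)) \<le> hausdorff_content s (1 / Suc n) A + ennreal (1 / Suc n)" for n
    using near_optimal_cover[of s "1 / Suc n" A "1 / Suc n"] cont[of n] assms
    by (metis of_nat_0_less_iff order.strict_trans1 zero_less_Suc zero_less_divide_1_iff)
  then obtain U where U: "\<And>n. U n \<in> delta_covers (1 / Suc n) A"
    "\<And>n. (\<Sum>i. diam_pow s (U n i)) \<le> hausdorff_content s (1 / Suc n) A + ennreal (1 / Suc n)"
    by metis
  define B where "B = (\<Inter>n. \<Union>i. closure (U n i))"
  have AB: "A \<subseteq> B"
  proof
    fix x assume "x \<in> A"
    then have "\<exists>i. x \<in> U n i" for n using U(1)[of n] unfolding delta_covers_def by blast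
    then show "x \<in> B" unfolding B_def using closure_subset by fastforce
  qed
  have cover: "(\<lambda>i. closure (U n i)) \<in> delta_covers (1 / Suc n) B" for n
    using U(1)[of n] unfolding B_def delta_covers_def by (auto simp: diameter_closure)
  have "hausdorff_content s \<delta> B \<le> hausdorff_measure s A" if "0 < \<delta>" for \<delta>
  proof (rule ennreal_le_epsilon)
    fix e :: real assume "0 < e"
    with that have "0 < min \<delta> e" by simp
    then obtain n where "1 / real (Suc n) < min \<delta> e" by (rule nat_approx_posE)
    then have n: "1 / Suc n \<le> \<delta>" "1 / Suc n \<le> e" by auto
    have "hausdorff_content s \<delta> B \<le> hausdorff_content s (1 / Suc n) B"
      by (rule hausdorff_content_antimono) (rule n)
    also have "\<dots> \<le> (\<Sum>i. diam_pow s (closure (U n i)))"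
      unfolding hausdorff_content_def by (rule INF_lower) (rule cover)
    also have "\<dots> = (\<Sum>i. diam_pow s (U n i))"
      using U(1)[of n] by (simp add: diam_pow_closure delta_covers_def)
    also have "\<dots> \<le> hausdorff_content s (1 / Suc n) A + ennreal (1 / Suc n)" by (rule U(2))
    also have "\<dots> \<le> hausdorff_measure s A + ennreal e"
      by (intro add_mono cont ennreal_leI n)
    finally show "hausdorff_content s \<delta> B \<le> hausdorff_measure s A + ennreal e" .
  qed
  then have "hausdorff_measure s B \<le> hausdorff_measure s A"
    unfolding hausdorff_measure_def[of s B] by (intro SUP_least) auto
  with hausdorff_measure_mono[OF AB, of s] have "hausdorff_measure s B = hausdorff_measure s A" by simp
  moreover have "B \<in> sets borel" unfolding B_def by measurable
  ultimately show thesis using that AB by blast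
qed

text \<open>
  A hull \<open>B\<close> of \<open>E\<close> exceeds \<open>E\<close> by a set that is null because \<open>E\<close> is measurable. Removing a null
  hull of this set from \<open>B\<close> leaves a Borel subset of \<open>E\<close> with full measure, to which inner regularity
  applies.
\<close>

lemma compact_subset_of_positive_measure:
  fixes E :: "'a::{second_countable_topology, complete_space} set"
  assumes E: "hausdorff_measurable s E" and pos: "0 < hausdorff_measure s E"
    and fin: "hausdorff_measure s E < \<infinity>"
  obtains K where "compact K" "K \<subseteq> E" "0 < hausdorff_measure s K"
proof -
  obtain B where B: "B \<in> sets borel" "E \<subseteq> B" "hausdorff_measure s B = hausdorff_measure s E"
    using borel_hull[OF fin] .
  have "hausdorff_measure s E + hausdorff_measure s (B - E) = hausdorff_measure s E + 0"
    using hausdorff_measurable_split[OF E, of B] B by (simp add: Int_absorb1)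
  then have N: "hausdorff_measure s (B - E) = 0"
    using fin by (auto simp: ennreal_add_left_cancel)
  obtain B' where B': "B' \<in> sets borel" "B - E \<subseteq> B'" "hausdorff_measure s B' = 0"
    using borel_hull[of s "B - E"] N by auto
  define S where "S = B - B'"
  have S: "S \<in> sets borel" "S \<subseteq> E" unfolding S_def using B B' by auto
  have "E \<subseteq> S \<union> B'" unfolding S_def using B by auto
  then have "hausdorff_measure s E \<le> hausdorff_measure s S + hausdorff_measure s B'"
    by (meson hausdorff_measure_Un_le hausdorff_measure_mono order_trans)
  then have S_pos: "0 < hausdorff_measure s S" using pos B' by auto
  let ?M = "hausdorff_on s S"
  note em = emeasure_hausdorff_on[OF borel_hausdorff_measurable[OF S(1)]]
  have "emeasure ?M (space ?M) \<noteq> \<infinity>"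
    using em[of UNIV s] hausdorff_measure_mono[OF S(2), of s] fin sets_eq_imp_space_eq[OF sets_hausdorff_on[of s S]]
    by (auto simp: top_unique)
  then have "emeasure ?M S = (SUP K \<in> {K. K \<subseteq> S \<and> compact K}. emeasure ?M K)"
    by (rule inner_regular[OF sets_hausdorff_on]) (rule S)
  moreover have "0 < emeasure ?M S" using em[OF S(1)] S_pos by simp
  ultimately obtain K where K: "K \<subseteq> S" "compact K" "0 < emeasure ?M K"
    by (auto simp: less_SUP_iff)
  have "0 < hausdorff_measure s K"
    using K em[of K s] by (simp add: borel_compact Int_absorb1)
  then show thesis using that K S by blast
qed

section \<open>Lower bounds for the dimension\<close>

text \<open>
  A cover of \<open>S\<close> pulls back under \<open>p\<close> to a cover of \<open>[0,1)\<close>, and the preimage of a set of diameter \<open>d\<close>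
  has diameter at most \<open>C * d powr s\<close>. As \<open>[0,1)\<close> has Lebesgue measure \<open>1\<close>, the sum of the \<open>s\<close>-th
  powers of the diameters cannot be small. So Lebesgue measure on the parameter interval takes the
  place of a mass distribution on \<open>S\<close>.
\<close>

lemma hausdorff_measure_pos_if_holder_inverse:
  fixes p :: "real \<Rightarrow> 'a::metric_space"
  assumes "0 \<le> s" "0 < C" and S: "p ` {0..<1} \<subseteq> S"
    and holder: "\<And>t u. t \<in> {0..<1} \<Longrightarrow> u \<in> {0..<1} \<Longrightarrow> \<bar>t - u\<bar> \<le> C * dist (p t) (p u) powr s"
  shows "0 < hausdorff_measure s S"
proof -
  have "ennreal (1 / (2 * C)) \<le> hausdorff_content s 1 S"
    unfolding hausdorff_content_def
  proof (rule INF_greatest)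
    fix U assume U: "U \<in> delta_covers 1 S"
    \<comment> \<open>The preimage of \<open>U i\<close> lies in the interval of radius \<open>d i\<close> around any one of its points.\<close>
    define d where "d i = C * (if s = 0 then 1 else diameter (U i) powr s)" for i
    define J where "J i = (if \<exists>t\<in>{0..<1}. p t \<in> U i
       then let t = (SOME t. t \<in> {0..<1} \<and> p t \<in> U i) in {t - d i .. t + d i} else {})" for i
    have d: "0 \<le> d i" for i unfolding d_def using \<open>0 < C\<close> by simp
    have "{0..<1} \<subseteq> (\<Union>i. J i)"
    proof
      fix u :: real assume u: "u \<in> {0..<1}"
      then obtain i where i: "p u \<in> U i" using U S unfolding delta_covers_def by blast
      define t where "t = (SOME t. t \<in> {0..<1} \<and> p t \<in> U i)"
      have t: "t \<in> {0..<1} \<and> p t \<in> U i" unfolding t_def by (rule someI[of _ u]) (use u i in auto)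
      have "dist (p t) (p u) \<le> diameter (U i)"
        using U t i by (intro diameter_bounded_bound) (auto simp: delta_covers_def)
      then have "dist (p t) (p u) powr s \<le> (if s = 0 then 1 else diameter (U i) powr s)"
        using \<open>0 \<le> s\<close> by (auto intro: powr_mono2)
      then have "\<bar>t - u\<bar> \<le> d i"
        using holder[of t u] t u \<open>0 < C\<close> unfolding d_def by (meson mult_left_mono less_imp_le order_trans)
      then have "u \<in> J i" unfolding J_def t_def[symmetric] Let_def using u i by auto
      then show "u \<in> (\<Union>i. J i)" by blast
    qed
    then have "emeasure lborel {0..<1::real} \<le> emeasure lborel (\<Union>i. J i)"
      by (rule emeasure_mono) (auto simp: J_def Let_def)
    also have "\<dots> \<le> (\<Sum>i. emeasure lborel (J i))"
      by (rule emeasure_subadditive_countably) (auto simp: J_def Let_def)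
    also have "\<dots> \<le> (\<Sum>i. ennreal (2 * C) * diam_pow s (U i))"
    proof (intro suminf_le)
      fix i
      show "emeasure lborel (J i) \<le> ennreal (2 * C) * diam_pow s (U i)"
        using d[of i] \<open>0 < C\<close> by (auto simp: J_def Let_def diam_pow_def d_def ennreal_mult[symmetric])
    qed auto
    also have "\<dots> = ennreal (2 * C) * (\<Sum>i. diam_pow s (U i))" by simp
    finally have "1 \<le> ennreal (2 * C) * (\<Sum>i. diam_pow s (U i))" by simp
    then have "ennreal (1 / (2 * C)) * 1 \<le> ennreal (1 / (2 * C)) * (ennreal (2 * C) * (\<Sum>i. diam_pow s (U i)))"
      by (rule mult_left_mono) simp
    also have "\<dots> = (\<Sum>i. diam_pow s (U i))"
      using \<open>0 < C\<close> by (simp add: mult.assoc[symmetric] ennreal_mult[symmetric])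
    finally show "ennreal (1 / (2 * C)) \<le> (\<Sum>i. diam_pow s (U i))" by simp
  qed
  then have "ennreal (1 / (2 * C)) \<le> hausdorff_measure s S"
    using hausdorff_content_le_measure[of 1 s S] by auto
  moreover have "0 < ennreal (1 / (2 * C))" using \<open>0 < C\<close> by (simp add: ennreal_less_zero_iff)
  ultimately show ?thesis by (rule less_le_trans[rotated])
qed

lemma hausdorff_dim_mono:
  assumes "A \<subseteq> B" shows "hausdorff_dim A \<le> hausdorff_dim B"
  unfolding hausdorff_dim_def
proof (rule Inf_superset_mono)
  show "{ennreal s |s. 0 \<le> s \<and> hausdorff_measure s B = 0} \<subseteq> {ennreal s |s. 0 \<le> s \<and> hausdorff_measure s A = 0}"
  proof clarify
    fix s :: real assume "0 \<le> s" "hausdorff_measure s B = 0"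
    then show "\<exists>t. ennreal s = ennreal t \<and> 0 \<le> t \<and> hausdorff_measure t A = 0"
      using hausdorff_measure_mono[OF assms, of s] by auto
  qed
qed

lemma hausdorff_dim_ge_one:
  assumes "\<And>s. 0 \<le> s \<Longrightarrow> s < 1 \<Longrightarrow> 0 < hausdorff_measure s A"
  shows "1 \<le> hausdorff_dim A"
  unfolding hausdorff_dim_def
proof (rule Inf_greatest)
  fix x assume "x \<in> {ennreal s |s. 0 \<le> s \<and> hausdorff_measure s A = 0}"
  then obtain s where "x = ennreal s" "0 \<le> s" "hausdorff_measure s A = 0" by blast
  then show "1 \<le> x" using assms[of s] by (cases "s < 1") auto
qed

section \<open>Lipschitz extension\<close>

text \<open>
  McShane's formula: the smallest of the cones of slope \<open>L\<close> that stand on the graph of \<open>f\<close>.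
\<close>

lemma mcshane_extension:
  fixes f :: "'a::metric_space \<Rightarrow> real"
  assumes "A \<noteq> {}" and lip: "L-lipschitz_on A f"
  obtains g where "L-lipschitz_on UNIV g" "\<And>x. x \<in> A \<Longrightarrow> g x = f x"
proof -
  have L: "0 \<le> L" using lip by (rule lipschitz_on_nonneg)
  have fL: "f y \<le> f z + L * dist y z" if "y \<in> A" "z \<in> A" for y z
    using lipschitz_onD[OF lip that] by (simp add: dist_real_def)
  define g where "g x = (INF y\<in>A. f y + L * dist x y)" for x
  obtain z where z: "z \<in> A" using \<open>A \<noteq> {}\<close> by blast
  have bdd: "bdd_below ((\<lambda>y. f y + L * dist x y) ` A)" for x
  proof (rule bdd_belowI2)
    fix y assume "y \<in> A"
    have "f z \<le> f y + L * (dist z x + dist x y)"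
      using fL[OF z \<open>y \<in> A\<close>] mult_left_mono[OF dist_triangle[of z y x] L] by linarith
    then show "f z - L * dist z x \<le> f y + L * dist x y" by (simp add: algebra_simps)
  qed
  have le: "g x \<le> g x' + L * dist x x'" for x x'
  proof -
    have "g x - L * dist x x' \<le> g x'"
      unfolding g_def[of x']
    proof (rule cINF_greatest[OF \<open>A \<noteq> {}\<close>])
      fix y assume "y \<in> A"
      then have "g x \<le> f y + L * dist x y"
        unfolding g_def by (rule cINF_lower[OF bdd])
      also have "\<dots> \<le> f y + L * (dist x x' + dist x' y)"
        by (intro add_left_mono mult_left_mono dist_triangle L)
      finally show "g x - L * dist x x' \<le> f y + L * dist x' y" by (simp add: algebra_simps)
    qed
    then show ?thesis by simp
  qed
  have "L-lipschitz_on UNIV g"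
  proof (rule lipschitz_onI[OF _ L])
    fix x y
    show "dist (g x) (g y) \<le> L * dist x y"
      using le[of x y] le[of y x] by (simp add: dist_real_def dist_commute abs_le_iff)
  qed
  moreover have "g x = f x" if "x \<in> A" for x
  proof (rule antisym)
    show "g x \<le> f x" unfolding g_def using cINF_lower[OF bdd that, of x] by simp
    show "f x \<le> g x" unfolding g_def by (rule cINF_greatest[OF \<open>A \<noteq> {}\<close>]) (rule fL[OF that])
  qed
  ultimately show thesis using that by blast
qed

text \<open>
  Extending the components separately costs a factor \<open>CARD('n)\<close> in the constant, which is harmless
  where only the existence of some Lipschitz constant matters.
\<close>

lemma lipschitz_extension_vec:
  fixes f :: "'a::metric_space \<Rightarrow> real ^ 'n"
  assumes "A \<noteq> {}" and lip: "L-lipschitz_on A f"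
  obtains g where "(real CARD('n) * L)-lipschitz_on UNIV g" "\<And>x. x \<in> A \<Longrightarrow> g x = f x"
proof -
  have L: "0 \<le> L" using lip by (rule lipschitz_on_nonneg)
  have "\<exists>h. L-lipschitz_on UNIV h \<and> (\<forall>x\<in>A. h x = f x $ i)" for i
  proof -
    have "L-lipschitz_on A (\<lambda>x. f x $ i)"
    proof (rule lipschitz_onI[OF _ L])
      fix x y assume "x \<in> A" "y \<in> A"
      then show "dist (f x $ i) (f y $ i) \<le> L * dist x y"
        using lipschitz_onD[OF lip] dist_vec_nth_le[of "f x" i "f y"] by (meson order_trans)
    qed
    with \<open>A \<noteq> {}\<close> obtain h where "L-lipschitz_on UNIV h" "\<And>x. x \<in> A \<Longrightarrow> h x = f x $ i"
      by (rule mcshane_extension) blast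
    then show ?thesis by blast
  qed
  then obtain h where h: "\<And>i. L-lipschitz_on UNIV (h i)" "\<And>i x. x \<in> A \<Longrightarrow> h i x = f x $ i"
    by metis
  define g where "g x = (\<chi> i. h i x)" for x
  have "(real CARD('n) * L)-lipschitz_on UNIV g"
  proof (rule lipschitz_onI)
    fix x y
    have "dist (g x) (g y) \<le> (\<Sum>i\<in>UNIV. \<bar>(g x - g y) $ i\<bar>)"
      unfolding dist_norm by (rule norm_le_l1_cart)
    also have "\<dots> \<le> (\<Sum>i\<in>(UNIV::'n set). L * dist x y)"
      using lipschitz_onD[OF h(1)] by (intro sum_mono) (simp add: g_def dist_real_def)
    finally show "dist (g x) (g y) \<le> real CARD('n) * L * dist x y" by simp
  qed (use L in simp)
  moreover have "g x = f x" if "x \<in> A" for x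
    using h(2)[OF that] by (simp add: g_def vec_eq_iff)
  ultimately show thesis using that by blast
qed

text \<open>
  Read \<open>\<theta> t\<close> as the time at which a traveller of speed at most \<open>1\<close> is at \<open>p t\<close>. The travel time
  suffices between any two appointments, so the partial map from times to places is Lipschitz, and
  it extends to the whole time interval. No path between the appointments has to be constructed.
\<close>

lemma covered_by_lipschitz_image:
  fixes p :: "'b \<Rightarrow> real ^ 'n" and \<theta> :: "'b \<Rightarrow> real"
  assumes "T \<noteq> {}" and "0 < S" and \<theta>: "\<And>t. t \<in> T \<Longrightarrow> \<theta> t \<in> {0..S}"
    and lip: "\<And>t u. t \<in> T \<Longrightarrow> u \<in> T \<Longrightarrow> dist (p t) (p u) \<le> \<bar>\<theta> t - \<theta> u\<bar>"
  shows "\<exists>(g :: real \<Rightarrow> real ^ 'n) L. L-lipschitz_on {0..1} g \<and> p ` T \<subseteq> g ` {0..1}"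
proof -
  define A where "A = (\<lambda>t. \<theta> t / S) ` T"
  define sel where "sel a = (SOME t. t \<in> T \<and> \<theta> t / S = a)" for a
  have sel: "sel a \<in> T \<and> \<theta> (sel a) / S = a" if a: "a \<in> A" for a
    unfolding sel_def by (rule someI_ex) (use a in \<open>auto simp: A_def\<close>)
  have p_sel: "p (sel (\<theta> t / S)) = p t" if t: "t \<in> T" for t
  proof -
    have "\<theta> t / S \<in> A" using t by (auto simp: A_def)
    from sel[OF this] have "\<theta> (sel (\<theta> t / S)) = \<theta> t" "sel (\<theta> t / S) \<in> T" using \<open>0 < S\<close> by auto
    with lip[of "sel (\<theta> t / S)" t] t show ?thesis by simp
  qed
  have "S-lipschitz_on A (\<lambda>a. p (sel a))"
  proof (rule lipschitz_onI)
    fix a b assume ab: "a \<in> A" "b \<in> A"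
    have "dist (p (sel a)) (p (sel b)) \<le> \<bar>\<theta> (sel a) - \<theta> (sel b)\<bar>"
      using sel ab by (intro lip) auto
    moreover have "\<theta> (sel a) = S * a" "\<theta> (sel b) = S * b" using sel ab \<open>0 < S\<close> by (auto simp: field_simps)
    ultimately show "dist (p (sel a)) (p (sel b)) \<le> S * dist a b"
      using \<open>0 < S\<close> by (simp add: dist_real_def right_diff_distrib[symmetric] abs_mult)
  qed (use \<open>0 < S\<close> in simp)
  moreover have "A \<noteq> {}" using \<open>T \<noteq> {}\<close> by (simp add: A_def)
  ultimately obtain g where g: "(real CARD('n) * S)-lipschitz_on UNIV g" "\<And>a. a \<in> A \<Longrightarrow> g a = p (sel a)"
    using lipschitz_extension_vec[of A S "\<lambda>a. p (sel a)"] by metis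
  have "p ` T \<subseteq> g ` {0..1}"
  proof clarify
    fix t assume t: "t \<in> T"
    then have "g (\<theta> t / S) = p t" using g(2)[of "\<theta> t / S"] p_sel by (auto simp: A_def)
    moreover have "\<theta> t / S \<in> {0..1}" using \<theta>[OF t] \<open>0 < S\<close> by simp
    ultimately show "p t \<in> g ` {0..1}" by (metis image_eqI)
  qed
  moreover have "(real CARD('n) * S)-lipschitz_on {0..1} g"
    by (rule lipschitz_on_subset[OF g(1) subset_UNIV])
  ultimately show ?thesis by blast
qed

section \<open>Branching numbers and radii of the tree\<close>

definition branching :: "nat \<Rightarrow> nat" where
  "branching k = 2 ^ (k ^ 2)"

lemma branching_pos: "0 < branching k"
  by (simp add: branching_def)

definition node_count :: "(nat \<Rightarrow> nat) \<Rightarrow> nat \<Rightarrow> nat" where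
  "node_count m k = (\<Prod>i<k. m i)"

text \<open>
  The radii shrink by the factor \<open>\<sigma> / (\<Lambda> ^ k * m k)\<close>: the density bound of generation \<open>k\<close> is a
  multiple of \<open>\<Lambda> powr (- k)\<close>, and \<open>m k\<close> children have to find room. The length terms
  \<open>r k * N (Suc k)\<close> have the ratios \<open>\<sigma> * 2 ^ (2 * k + 1) / \<Lambda> ^ k \<le> 1 / 4\<close>. For the dimension, the
  quotients \<open>1 / (N k * r (Suc k) powr s)\<close> have ratios of the order
  \<open>2 powr (s * (k + 1)^2 - k^2)\<close> up to a factor that is exponential in \<open>k\<close>, so the quotients
  eventually decrease.
\<close>

lemma tree_scales:
  fixes r :: "nat \<Rightarrow> real"
  defines "m \<equiv> branching"
  defines "N \<equiv> node_count m"
  assumes \<sigma>: "0 < \<sigma>" "\<sigma> \<le> 1 / 8" and \<Lambda>: "16 \<le> \<Lambda>"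
    and r: "0 < r 0" "\<And>k. r (Suc k) = \<sigma> / (\<Lambda> ^ k * m k) * r k"
  shows "0 < r k" "r (Suc k) \<le> r k / 8" "summable (\<lambda>k. r k * N (Suc k))"
    "0 \<le> s \<Longrightarrow> s < 1 \<Longrightarrow> \<exists>C>0. \<forall>k. 1 / N k \<le> C * r (Suc k) powr s"
proof -
  define \<rho> where "\<rho> k = \<sigma> / (\<Lambda> ^ k * m k)" for k
  have m_pos: "0 < m k" for k by (simp add: m_def branching_def)
  have \<rho>_pos: "0 < \<rho> k" for k using \<sigma> \<Lambda> m_pos[of k] by (simp add: \<rho>_def)
  have N_pos: "0 < N k" for k unfolding N_def node_count_def using m_pos by (simp add: prod_pos)
  have N_Suc: "N (Suc k) = N k * m k" for k by (simp add: N_def node_count_def)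
  have r': "r (Suc k) = \<rho> k * r k" for k using r(2) by (simp add: \<rho>_def)
  show r_pos: "0 < r k" for k by (induction k) (simp_all add: r(1) r' \<rho>_pos)
  have \<rho>_le: "\<rho> k \<le> 1 / 8" for k
  proof -
    have "1 * 1 \<le> \<Lambda> ^ k * real (m k)"
      using \<Lambda> m_pos[of k] by (intro mult_mono one_le_power) auto
    then have "\<rho> k \<le> \<sigma> / 1" unfolding \<rho>_def using \<sigma> by (intro divide_left_mono) auto
    with \<sigma> show ?thesis by simp
  qed
  show "r (Suc k) \<le> r k / 8" for k
    using mult_right_mono[OF \<rho>_le[of k], of "r k"] r_pos[of k] by (simp add: r')
  show "summable (\<lambda>k. r k * N (Suc k))"
  proof (rule summable_ratio_test[of "1/4" 0])
    fix k
    have "\<rho> k * m (Suc k) \<le> 1 / 4"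
    proof -
      have "(Suc k) ^ 2 = k ^ 2 + 2 * k + 1" by (simp add: power2_eq_square)
      then have "real (m (Suc k)) = m k * 4 ^ k * 2"
        unfolding m_def branching_def by (simp only: power_add power_mult) simp
      then have "\<rho> k * m (Suc k) = 2 * \<sigma> * (4 ^ k / \<Lambda> ^ k)"
        using m_pos[of k] by (simp add: \<rho>_def)
      also have "\<dots> \<le> 2 * (1/8) * 1"
        using \<sigma> \<Lambda> by (intro mult_mono) (auto simp: power_mono)
      finally show ?thesis by simp
    qed
    then have "(\<rho> k * m (Suc k)) * (r k * N (Suc k)) \<le> 1 / 4 * (r k * N (Suc k))"
      using r_pos[of k] by (intro mult_right_mono) auto
    then show "norm (r (Suc k) * N (Suc (Suc k))) \<le> 1 / 4 * norm (r k * N (Suc k))"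
      using r_pos[of k] \<rho>_pos[of k] by (simp add: r' N_Suc[of "Suc k"] mult_ac abs_mult)
  qed simp
  assume s: "0 \<le> s" "s < 1"
  define v where "v k = 1 / (N k * r (Suc k) powr s)" for k
  have "eventually (\<lambda>k. \<rho> (Suc k) powr (- s) \<le> m k) sequentially"
  proof -
    let ?f = "\<lambda>k. (ln 2 * real k ^ 2 - s * (real (Suc k) ^ 2 * ln 2 + real (Suc k) * ln \<Lambda> - ln \<sigma>)) / real k ^ 2"
    have "?f \<longlonglongrightarrow> ln 2 - s * ln 2" by real_asymp
    moreover have "0 < ln 2 - s * ln 2" using s by simp
    ultimately have "eventually (\<lambda>k. 0 < ?f k) sequentially" by (rule order_tendstoD)
    then show ?thesis
    proof eventually_elim
      case (elim k)
      have ln_\<rho>: "ln (\<rho> (Suc k)) = ln \<sigma> - real (Suc k) * ln \<Lambda> - real (Suc k) ^ 2 * ln 2"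
        using \<sigma> \<Lambda> by (simp add: \<rho>_def m_def branching_def ln_div ln_mult ln_realpow del: power_Suc)
      have "0 < ln 2 * real k ^ 2 - s * (real (Suc k) ^ 2 * ln 2 + real (Suc k) * ln \<Lambda> - ln \<sigma>)"
        using elim by (simp add: zero_less_divide_iff split: if_splits)
      then have "- s * ln (\<rho> (Suc k)) \<le> real (k ^ 2) * ln 2"
        unfolding ln_\<rho> by (simp add: algebra_simps)
      then have "exp (- s * ln (\<rho> (Suc k))) \<le> exp (real (k ^ 2) * ln 2)" by simp
      also have "exp (real (k ^ 2) * ln 2) = real (m k)"
        by (simp only: exp_of_nat_mult) (simp add: m_def branching_def)
      finally show ?case using \<rho>_pos[of "Suc k"] by (simp add: powr_def)
    qed
  qed
  then obtain K where K: "\<And>k. K \<le> k \<Longrightarrow> \<rho> (Suc k) powr (- s) \<le> m k"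
    by (auto simp: eventually_sequentially)
  have v_pos: "0 < v k" for k using N_pos[of k] r_pos[of "Suc k"] by (simp add: v_def)
  have v_dec: "v (Suc k) \<le> v k" if "K \<le> k" for k
  proof -
    have "v (Suc k) = v k * (\<rho> (Suc k) powr (- s) / m k)"
      using \<rho>_pos[of "Suc k"] r_pos[of "Suc k"]
      by (simp add: v_def r'[of "Suc k"] N_Suc powr_mult powr_minus field_simps)
    also have "\<dots> \<le> v k * 1"
      using K[OF that] v_pos[of k] m_pos[of k] by (intro mult_left_mono) auto
    finally show ?thesis by simp
  qed
  define C where "C = Max (v ` {..K})"
  have vC: "v k \<le> C" for k
  proof (cases "k \<le> K")
    case True then show ?thesis unfolding C_def by simp
  next
    case False
    then have "K \<le> k" by simp
    then have "v k \<le> v K"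
    proof (induction k rule: dec_induct)
      case (step n) then show ?case using v_dec[of n] by simp
    qed simp
    also have "\<dots> \<le> C" unfolding C_def by simp
    finally show ?thesis .
  qed
  have "0 < C" using vC[of 0] v_pos[of 0] by simp
  moreover have "1 / N k \<le> C * r (Suc k) powr s" for k
    using vC[of k] N_pos[of k] r_pos[of "Suc k"] by (simp add: v_def field_simps)
  ultimately show "\<exists>C>0. \<forall>k. 1 / N k \<le> C * r (Suc k) powr s" by blast
qed

section \<open>The limit set of a separated tree\<close>

text \<open>
  The balls of generation \<open>k\<close> are numbered by \<open>i < N k\<close>, and the children of ball \<open>i\<close> by
  \<open>i * m k + j\<close> with \<open>j < m k\<close>. So the ball of generation \<open>k\<close> with address \<open>t\<close> has the number
  \<open>\<lfloor>N k * t\<rfloor>\<close>, and \<open>p t\<close> is the limit of the centres. The radii decrease at least by the factor \<open>8\<close>, so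
  \<open>p t\<close> is within \<open>8/7 * r k\<close> of the centre of generation \<open>k\<close>. Hence siblings at distance \<open>4 * r (Suc k)\<close> keep
  their limit points at least \<open>(4 - 16/7) * r (Suc k)\<close> apart.
\<close>

lemma separated_tree_limit:
  fixes K :: "'a::complete_space set" and r :: "nat \<Rightarrow> real" and m :: "nat \<Rightarrow> nat"
    and good :: "nat \<Rightarrow> 'a \<Rightarrow> bool"
  assumes K: "closed K" "\<And>k x. good k x \<Longrightarrow> x \<in> K"
    and root: "good 0 x0"
    and m: "\<And>k. 0 < m k"
    and r: "\<And>k. 0 < r k" "\<And>k. r (Suc k) \<le> r k / 8"
    and child: "\<And>k x. good k x \<Longrightarrow> \<exists>c. (\<forall>j<m k. good (Suc k) (c j) \<and> dist x (c j) \<le> r k) \<and>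
        (\<forall>i<m k. \<forall>j<m k. i \<noteq> j \<longrightarrow> 4 * r (Suc k) \<le> dist (c i) (c j))"
  defines "N \<equiv> node_count m"
  obtains p :: "real \<Rightarrow> 'a" where "p ` {0..<1} \<subseteq> K"
    "\<And>t u k. t \<in> {0..<1} \<Longrightarrow> u \<in> {0..<1} \<Longrightarrow> \<lfloor>real (N k) * t\<rfloor> = \<lfloor>real (N k) * u\<rfloor> \<Longrightarrow> \<lfloor>real (N (Suc k)) * t\<rfloor> \<noteq> \<lfloor>real (N (Suc k)) * u\<rfloor> \<Longrightarrow>
       r (Suc k) \<le> dist (p t) (p u) \<and> dist (p t) (p u) \<le> 4 * r k"
proof -
  have "\<forall>k x. \<exists>c. good k x \<longrightarrow> (\<forall>j<m k. good (Suc k) (c j) \<and> dist x (c j) \<le> r k) \<and>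
        (\<forall>i<m k. \<forall>j<m k. i \<noteq> j \<longrightarrow> 4 * r (Suc k) \<le> dist (c i) (c j))"
    using child by blast
  then obtain ch where ch: "\<And>k x. good k x \<Longrightarrow> (\<forall>j<m k. good (Suc k) (ch k x j) \<and> dist x (ch k x j) \<le> r k) \<and>
        (\<forall>i<m k. \<forall>j<m k. i \<noteq> j \<longrightarrow> 4 * r (Suc k) \<le> dist (ch k x i) (ch k x j))"
    by metis
  \<comment> \<open>\<open>X k i\<close> is the centre of ball \<open>i\<close> of generation \<open>k\<close>.\<close>
  define X where "X = rec_nat (\<lambda>_. x0) (\<lambda>k Y i. ch k (Y (i div m k)) (i mod m k))"
  have X0: "X 0 i = x0" for i by (simp add: X_def)
  have XS: "X (Suc k) i = ch k (X k (i div m k)) (i mod m k)" for k i by (simp add: X_def)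
  have good: "good k (X k i)" for k i
    by (induction k arbitrary: i) (use root ch m in \<open>auto simp: X0 XS\<close>)
  define a where "a k t = nat \<lfloor>real (N k) * t\<rfloor>" for k and t :: real
  have N_Suc: "N (Suc k) = N k * m k" for k by (simp add: N_def node_count_def)
  have a_div: "a (Suc k) t div m k = a k t" if "0 \<le> t" for k t
  proof -
    have "\<lfloor>real (N (Suc k)) * t\<rfloor> div int (m k) = \<lfloor>real (N (Suc k)) * t / real (m k)\<rfloor>"
      using floor_divide_real_eq_div[of "int (m k)" "real (N (Suc k)) * t"] by simp
    also have "real (N (Suc k)) * t / real (m k) = real (N k) * t" using m[of k] by (simp add: N_Suc)
    finally show ?thesis
      unfolding a_def
      using nat_div_distrib'[of "int (m k)" "\<lfloor>real (N (Suc k)) * t\<rfloor>"] by simp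
  qed
  have step: "dist (X k (a k t)) (X (Suc k) (a (Suc k) t)) \<le> r k" if "0 \<le> t" for k t
    using ch[OF good[of k "a k t"]] m[of k] by (simp add: XS a_div[OF that])
  have r_geom: "r (k + n) \<le> r k * (1/8)^n" for k n
  proof (induction n)
    case (Suc n) then show ?case using r(2)[of "k + n"] by simp
  qed simp
  have near: "dist (X k (a k t)) (X (k + n) (a (k + n) t)) \<le> r k * (8/7) * (1 - (1/8)^n)"
    if "0 \<le> t" for k n t
  proof (induction n)
    case (Suc n)
    have "dist (X k (a k t)) (X (k + Suc n) (a (k + Suc n) t))
       \<le> dist (X k (a k t)) (X (k + n) (a (k + n) t)) + r (k + n)"
      using step[OF that, of "k + n"] dist_triangle[of "X k (a k t)" _ "X (k + n) (a (k + n) t)"]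
      by (smt (verit) add_Suc_right)
    also have "\<dots> \<le> r k * (8/7) * (1 - (1/8)^n) + r k * (1/8)^n"
      by (intro add_mono Suc.IH r_geom)
    also have "\<dots> = r k * (8/7) * (1 - (1/8)^Suc n)" by (simp add: field_simps)
    finally show ?case .
  qed simp
  have near': "dist (X k (a k t)) (X n (a n t)) \<le> r k * (8/7)" if "0 \<le> t" "k \<le> n" for k n t
  proof -
    have "r k * (8/7) * (1 - (1/8)^(n - k)) \<le> r k * (8/7) * 1"
      using r(1)[of k] by (intro mult_left_mono) auto
    with near[OF that(1), of k "n - k"] that(2) show ?thesis by simp
  qed
  have r_lim: "r \<longlonglongrightarrow> 0"
  proof (rule tendsto_sandwich[of "\<lambda>_. 0"])
    show "(\<lambda>n. r 0 * (1/8)^n) \<longlonglongrightarrow> 0" by (intro tendsto_mult_right_zero LIMSEQ_realpow_zero) auto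
  qed (use r(1) r_geom[of 0] in \<open>auto intro!: always_eventually less_imp_le\<close>)
  have Cau: "Cauchy (\<lambda>k. X k (a k t))" if "0 \<le> t" for t
    unfolding Cauchy_altdef2
  proof (intro allI impI)
    fix e :: real assume "0 < e"
    then have "eventually (\<lambda>k. r k < e / 2) sequentially"
      using r_lim by (intro order_tendstoD) auto
    then obtain k where k: "r k < e / 2" by (auto simp: eventually_sequentially)
    have "\<forall>n\<ge>k. dist (X n (a n t)) (X k (a k t)) < e"
      using near'[OF that, of k] k \<open>0 < e\<close> r(1)[of k] by (fastforce simp: dist_commute)
    then show "\<exists>N. \<forall>n\<ge>N. dist (X n (a n t)) (X N (a N t)) < e" by blast
  qed
  define p where "p t = lim (\<lambda>k. X k (a k t))" for t
  have lim: "(\<lambda>k. X k (a k t)) \<longlonglongrightarrow> p t" if "0 \<le> t" for t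
    unfolding p_def using Cauchy_convergent[OF Cau[OF that]] by (simp add: convergent_LIMSEQ_iff)
  have pK: "p t \<in> K" if "0 \<le> t" for t
    by (rule closed_sequentially[OF K(1) _ lim[OF that]]) (use K(2) good in blast)
  have pX: "dist (X k (a k t)) (p t) \<le> r k * (8/7)" if "0 \<le> t" for k t
  proof (rule Lim_dist_ubound[OF _ lim[OF that]])
    show "eventually (\<lambda>n. dist (X k (a k t)) (X n (a n t)) \<le> r k * (8/7)) sequentially"
      using near'[OF that] by (auto simp: eventually_sequentially)
  qed simp
  show thesis
  proof (rule that[of p])
    show "p ` {0..<1} \<subseteq> K" using pK by auto
    fix t u :: real and k
    assume tu: "t \<in> {0..<1}" "u \<in> {0..<1}"
      and eq: "\<lfloor>real (N k) * t\<rfloor> = \<lfloor>real (N k) * u\<rfloor>" and neq: "\<lfloor>real (N (Suc k)) * t\<rfloor> \<noteq> \<lfloor>real (N (Suc k)) * u\<rfloor>"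
    have t: "0 \<le> t" and u: "0 \<le> u" using tu by auto
    have same: "a k t = a k u" using eq by (simp add: a_def)
    have "0 \<le> \<lfloor>real (N (Suc k)) * t\<rfloor>" "0 \<le> \<lfloor>real (N (Suc k)) * u\<rfloor>" using t u by auto
    then have differ: "a (Suc k) t \<noteq> a (Suc k) u"
      using neq unfolding a_def by (simp add: eq_nat_nat_iff)
    have "a (Suc k) t mod m k \<noteq> a (Suc k) u mod m k"
      using differ a_div[OF t, of k] a_div[OF u, of k] same by (metis div_mult_mod_eq)
    then have "4 * r (Suc k) \<le> dist (X (Suc k) (a (Suc k) t)) (X (Suc k) (a (Suc k) u))"
      using ch[OF good[of k "a k t"]] m[of k] a_div[OF t, of k] a_div[OF u, of k] same by (simp add: XS)
    also have "\<dots> \<le> dist (X (Suc k) (a (Suc k) t)) (p t) + dist (p t) (p u) + dist (X (Suc k) (a (Suc k) u)) (p u)"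
      by (metis add.commute add_left_mono dist_commute dist_triangle dist_triangle_le dist_triangle2 dist_triangle3)
    finally have "r (Suc k) \<le> dist (p t) (p u)"
      using pX[OF t, of "Suc k"] pX[OF u, of "Suc k"] r(1)[of "Suc k"] by simp
    moreover have "dist (p t) (p u) \<le> 4 * r k"
      using pX[OF t, of k] pX[OF u, of k] same r(1)[of k] dist_triangle3[of "p t" "p u" "X k (a k t)"] by simp
    ultimately show "r (Suc k) \<le> dist (p t) (p u) \<and> dist (p t) (p u) \<le> 4 * r k" by simp
  qed
qed

text \<open>
  Once \<open>N k\<close> exceeds \<open>1 / (u - t)\<close>, the addresses \<open>t\<close> and \<open>u\<close> belong to different balls, while
  generation \<open>0\<close> has only one ball. They part just before the first generation that tells them apart.
\<close>

lemma branching_level: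
  fixes N :: "nat \<Rightarrow> nat" and t u :: real
  assumes "N 0 = 1" and large: "\<And>k. k \<le> N k" and t: "0 \<le> t" "t < u" "u < 1"
  obtains k where "\<lfloor>real (N k) * t\<rfloor> = \<lfloor>real (N k) * u\<rfloor>" "\<lfloor>real (N (Suc k)) * t\<rfloor> \<noteq> \<lfloor>real (N (Suc k)) * u\<rfloor>"
proof -
  let ?P = "\<lambda>k. \<lfloor>real (N k) * t\<rfloor> \<noteq> \<lfloor>real (N k) * u\<rfloor>"
  obtain n :: nat where n: "1 / (u - t) < n" using reals_Archimedean2 by blast
  have "1 < n * (u - t)" using n t by (simp add: field_simps)
  also have "\<dots> \<le> N n * (u - t)" using large[of n] t by (intro mult_right_mono) auto
  finally have "N n * t + 1 < N n * u" by (simp add: algebra_simps)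
  then have "?P n" by linarith
  define l where "l = (LEAST k. ?P k)"
  have l: "?P l" unfolding l_def using \<open>?P n\<close> by (rule LeastI)
  have "\<lfloor>t\<rfloor> = 0" "\<lfloor>u\<rfloor> = 0" using t by (auto simp: floor_eq_iff)
  then have "l \<noteq> 0" using l \<open>N 0 = 1\<close> by (intro notI) simp
  then obtain k where k: "l = Suc k" using not0_implies_Suc by blast
  have "\<not> ?P k" using not_less_Least[of k ?P] k unfolding l_def by simp
  with l k show thesis using that by blast
qed

text \<open>
  The timetable is \<open>\<theta> t = (\<Sum>k. 4 * r k * \<lfloor>N (Suc k) * t\<rfloor>)\<close>: it allows \<open>4 * r k\<close> for each step from a
  ball of generation \<open>k + 1\<close> to the next one. Addresses that part after generation \<open>k\<close> differ by at
  least one such step, and their points have distance at most \<open>4 * r k\<close>.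
\<close>

lemma lipschitz_image_through_tree:
  fixes p :: "real \<Rightarrow> real ^ 'n" and N :: "nat \<Rightarrow> nat" and r :: "nat \<Rightarrow> real"
  assumes N: "N 0 = 1" "\<And>k. k \<le> N k"
    and r: "\<And>k. 0 < r k" and sum: "summable (\<lambda>k. r k * N (Suc k))"
    and p: "\<And>t u k. t \<in> {0..<1} \<Longrightarrow> u \<in> {0..<1} \<Longrightarrow> \<lfloor>real (N k) * t\<rfloor> = \<lfloor>real (N k) * u\<rfloor> \<Longrightarrow>
       \<lfloor>real (N (Suc k)) * t\<rfloor> \<noteq> \<lfloor>real (N (Suc k)) * u\<rfloor> \<Longrightarrow> dist (p t) (p u) \<le> 4 * r k"
  shows "\<exists>(g :: real \<Rightarrow> real ^ 'n) L. L-lipschitz_on {0..1} g \<and> p ` {0..<1} \<subseteq> g ` {0..1}"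
proof -
  define f where "f t k = 4 * r k * \<lfloor>real (N (Suc k)) * t\<rfloor>" for t :: real and k
  define \<theta> where "\<theta> t = (\<Sum>k. f t k)" for t
  define B where "B k = 4 * (r k * N (Suc k))" for k
  have B: "summable B" unfolding B_def by (intro summable_mult sum)
  have f_bounds: "0 \<le> f t k \<and> f t k \<le> B k" if "t \<in> {0..<1}" for t k
  proof -
    have "0 \<le> \<lfloor>real (N (Suc k)) * t\<rfloor>" using that by simp
    moreover have "real (N (Suc k)) * t \<le> real (N (Suc k)) * 1" using that by (intro mult_left_mono) auto
    then have "real_of_int \<lfloor>real (N (Suc k)) * t\<rfloor> \<le> N (Suc k)" by linarith
    ultimately show ?thesis
      using r[of k] unfolding f_def B_def by (auto simp: mult.assoc intro!: mult_left_mono)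
  qed
  have f_sum: "summable (f t)" if "t \<in> {0..<1}" for t
    by (rule summable_comparison_test'[OF B, of 0]) (use f_bounds[OF that] in simp)
  \<comment> \<open>The summand \<open>1\<close> only makes the upper bound positive without a case distinction.\<close>
  have range: "\<theta> t \<in> {0..suminf B + 1}" if "t \<in> {0..<1}" for t
    using suminf_nonneg[OF f_sum[OF that]] suminf_le[OF _ f_sum[OF that] B] f_bounds[OF that]
    by (auto simp: \<theta>_def add_increasing2)
  have lt: "dist (p t) (p u) \<le> \<theta> u - \<theta> t" if tu: "t \<in> {0..<1}" "u \<in> {0..<1}" "t < u" for t u
  proof -
    obtain k where k: "\<lfloor>real (N k) * t\<rfloor> = \<lfloor>real (N k) * u\<rfloor>" "\<lfloor>real (N (Suc k)) * t\<rfloor> \<noteq> \<lfloor>real (N (Suc k)) * u\<rfloor>"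
      using branching_level[of N t u] N tu by auto
    have le: "\<lfloor>real (N (Suc j)) * t\<rfloor> \<le> \<lfloor>real (N (Suc j)) * u\<rfloor>" for j
      using tu by (intro floor_mono mult_left_mono) auto
    have diff: "f u j - f t j = 4 * r j * (\<lfloor>real (N (Suc j)) * u\<rfloor> - \<lfloor>real (N (Suc j)) * t\<rfloor>)" for j
      by (simp add: f_def right_diff_distrib)
    have "dist (p t) (p u) \<le> 4 * r k * 1" using p[OF tu(1,2) k] by simp
    also have "\<dots> \<le> 4 * r k * (\<lfloor>real (N (Suc k)) * u\<rfloor> - \<lfloor>real (N (Suc k)) * t\<rfloor>)"
    proof (rule mult_left_mono)
      have "1 \<le> \<lfloor>real (N (Suc k)) * u\<rfloor> - \<lfloor>real (N (Suc k)) * t\<rfloor>" using k(2) le[of k] by linarith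
      then show "1 \<le> real_of_int (\<lfloor>real (N (Suc k)) * u\<rfloor> - \<lfloor>real (N (Suc k)) * t\<rfloor>)" by linarith
    qed (use r[of k] in simp)
    also have "\<dots> = f u k - f t k" by (simp only: diff)
    also have "\<dots> = (\<Sum>j\<in>{k}. f u j - f t j)" by simp
    also have "\<dots> \<le> (\<Sum>j. f u j - f t j)"
    proof (rule sum_le_suminf)
      show "0 \<le> f u j - f t j" for j
        unfolding diff using r[of j] le[of j] by simp
    qed (use f_sum tu in \<open>auto intro: summable_diff\<close>)
    also have "\<dots> = \<theta> u - \<theta> t" unfolding \<theta>_def using f_sum tu by (intro suminf_diff[symmetric]) auto
    finally show ?thesis .
  qed
  have lip: "dist (p t) (p u) \<le> \<bar>\<theta> t - \<theta> u\<bar>" if "t \<in> {0..<1}" "u \<in> {0..<1}" for t u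
    using lt[of t u] lt[of u t] that by (cases t u rule: linorder_cases) (auto simp: dist_commute)
  have "0 < suminf B + 1"
    using suminf_nonneg[OF B] r by (simp add: B_def add_nonneg_pos less_imp_le)
  then show ?thesis
    by (intro covered_by_lipschitz_image[where \<theta> = \<theta> and S = "suminf B + 1"] range lip)
      simp_all
qed

section \<open>Trees in subsets of a regular set\<close>

text \<open>
  A separated subset of largest size is a net.
\<close>

lemma finite_net:
  fixes A :: "'a::metric_space set"
  assumes "0 \<le> d"
  assumes bound: "\<And>Y. finite Y \<Longrightarrow> Y \<subseteq> A \<Longrightarrow> (\<And>y z. y \<in> Y \<Longrightarrow> z \<in> Y \<Longrightarrow> y \<noteq> z \<Longrightarrow> d < dist y z) \<Longrightarrow> card Y \<le> n"
  obtains Y where "finite Y" "Y \<subseteq> A" "card Y \<le> n" "A \<subseteq> (\<Union>y\<in>Y. cball y d)"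
proof -
  define P where "P Y \<longleftrightarrow> finite Y \<and> Y \<subseteq> A \<and> (\<forall>y\<in>Y. \<forall>z\<in>Y. y \<noteq> z \<longrightarrow> d < dist y z)" for Y
  have "P {}" by (simp add: P_def)
  moreover have P_card: "card Y \<le> n" if "P Y" for Y using bound[of Y] that by (simp add: P_def)
  ultimately obtain Y where Y: "P Y" and max: "\<And>Z. P Z \<Longrightarrow> card Z \<le> card Y"
    using ex_has_greatest_nat[of P "{}" card "Suc n"] by (auto simp: le_imp_less_Suc le_SucI)
  have "x \<in> (\<Union>y\<in>Y. cball y d)" if "x \<in> A" for x
  proof (rule ccontr)
    assume x: "x \<notin> (\<Union>y\<in>Y. cball y d)"
    then have far: "d < dist y x" if "y \<in> Y" for y using that by (auto simp: not_le)
    then have "x \<notin> Y" using \<open>0 \<le> d\<close> by fastforce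
    have "d < dist y z" if yz: "y \<in> insert x Y" "z \<in> insert x Y" "y \<noteq> z" for y z
    proof -
      consider "y = x" "z \<in> Y" | "y \<in> Y" "z = x" | "y \<in> Y" "z \<in> Y" using yz by blast
      then show ?thesis
        using far[of y] far[of z] Y yz(3) unfolding P_def by cases (auto simp: dist_commute)
    qed
    with Y \<open>x \<in> A\<close> have "P (insert x Y)" unfolding P_def by blast
    from max[OF this] show False using Y \<open>x \<notin> Y\<close> by (simp add: P_def)
  qed
  then have "A \<subseteq> (\<Union>y\<in>Y. cball y d)" by blast
  moreover have "finite Y" "Y \<subseteq> A" using Y by (auto simp: P_def)
  ultimately show thesis using P_card[OF Y] by (intro that[of Y])
qed

text \<open>
  The model is the restriction of \<open>H^1\<close> to a regular set \<open>E\<close> of diameter \<open>D\<close>.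
\<close>

locale ahlfors_measure = finite_measure M for M :: "'a::metric_space measure" +
  fixes E :: "'a set" and a b D :: real
  assumes sets_M [simp]: "sets M = sets borel"
    and a: "0 < a" and b: "0 < b"
    and lower: "\<And>x r. x \<in> E \<Longrightarrow> 0 < r \<Longrightarrow> r < D \<Longrightarrow> a * r \<le> measure M (cball x r)"
    and upper: "\<And>x r. x \<in> E \<Longrightarrow> 0 < r \<Longrightarrow> r < D \<Longrightarrow> measure M (cball x r) \<le> b * r"
begin

text \<open>
  The balls of radius \<open>d / 2\<close> around the points are disjoint, each has mass at least \<open>a * d / 2\<close>, and
  together they fit into the ball of radius \<open>2 * r\<close>.
\<close>

lemma separated_card_le:
  assumes x: "x \<in> E" and r: "2 * r < D" and d: "0 < d" "d \<le> r"
    and Y: "finite Y" "Y \<subseteq> E \<inter> cball x r"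
    and sep: "\<And>y z. y \<in> Y \<Longrightarrow> z \<in> Y \<Longrightarrow> y \<noteq> z \<Longrightarrow> d < dist y z"
  shows "real (card Y) \<le> 4 * b * r / (a * d)"
proof -
  have "real (card Y) * (a * (d / 2)) = (\<Sum>y\<in>Y. a * (d / 2))" by simp
  also have "\<dots> \<le> (\<Sum>y\<in>Y. measure M (cball y (d / 2)))"
    using Y d r by (intro sum_mono lower) auto
  also have "\<dots> = measure M (\<Union>y\<in>Y. cball y (d / 2))"
  proof (rule finite_measure_finite_Union[symmetric, OF Y(1)])
    show "disjoint_family_on (\<lambda>y. cball y (d / 2)) Y"
      unfolding disjoint_family_on_def
    proof (intro ballI impI)
      fix y z assume yz: "y \<in> Y" "z \<in> Y" "y \<noteq> z"
      have False if "w \<in> cball y (d/2)" "w \<in> cball z (d/2)" for w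
        using sep[OF yz] that dist_triangle2[of y z w] by simp
      then show "cball y (d / 2) \<inter> cball z (d / 2) = {}" by blast
    qed
  qed auto
  also have "\<dots> \<le> measure M (cball x (2 * r))"
  proof (rule finite_measure_mono)
    have "dist x w \<le> 2 * r" if "y \<in> Y" "dist y w \<le> d / 2" for y w
    proof -
      have "dist x y \<le> r" using that Y(2) by auto
      then show ?thesis using that(2) d dist_triangle[of x w y] by linarith
    qed
    then show "(\<Union>y\<in>Y. cball y (d / 2)) \<subseteq> cball x (2 * r)" by auto
  qed simp
  also have "\<dots> \<le> b * (2 * r)" using x d r by (intro upper) auto
  finally show ?thesis using a d by (simp add: field_simps)
qed

text \<open>
  Cover \<open>A\<close> by the balls around a net of at most \<open>4 * b / (a * \<rho>)\<close> points. If each of them had mass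
  less than \<open>\<tau> / (16 * b / a) * (\<rho> * r)\<close>, then \<open>A\<close> would have mass at most \<open>\<tau> * r / 4\<close>.
\<close>

lemma dense_point_exists:
  assumes "x \<in> E" "2 * r < D" "0 < r" "0 < \<rho>" "\<rho> \<le> 1" "0 < \<tau>"
    and A: "A \<in> sets borel" "A \<subseteq> E \<inter> cball x r" and mass: "\<tau> * r / 2 \<le> measure M A"
  shows "\<exists>z\<in>A. \<tau> / (16 * b / a) * (\<rho> * r) \<le> measure M (A \<inter> cball z (\<rho> * r))"
proof (rule ccontr)
  assume asm: "\<not> ?thesis"
  have small: "measure M (A \<inter> cball z (\<rho> * r)) < \<tau> / (16 * b / a) * (\<rho> * r)" if "z \<in> A" for z
    using asm that by (meson not_le)
  let ?B = "4 * b * r / (a * (\<rho> * r))"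
  have \<rho>r: "\<rho> * r \<le> r" using assms by (simp add: mult_le_cancel_right1)
  have "card Y \<le> nat \<lfloor>?B\<rfloor>" if "finite Y" "Y \<subseteq> A"
    "\<And>y z. y \<in> Y \<Longrightarrow> z \<in> Y \<Longrightarrow> y \<noteq> z \<Longrightarrow> \<rho> * r < dist y z" for Y
  proof -
    have "real (card Y) \<le> ?B"
      using \<rho>r that assms by (intro separated_card_le[of x]) auto
    then show ?thesis by (rule le_nat_floor)
  qed
  then obtain Y where Y: "finite Y" "Y \<subseteq> A" "card Y \<le> nat \<lfloor>?B\<rfloor>" "A \<subseteq> (\<Union>y\<in>Y. cball y (\<rho> * r))"
    using finite_net[of "\<rho> * r" A "nat \<lfloor>?B\<rfloor>"] assms by (metis less_imp_le mult_pos_pos)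
  have B_pos: "0 \<le> ?B" using a b assms by simp
  have card: "real (card Y) \<le> ?B"
    using Y(3) B_pos by (metis of_nat_mono of_nat_floor order_trans)
  have "A = (\<Union>y\<in>Y. A \<inter> cball y (\<rho> * r))" using Y(4) by blast
  then have "measure M A = measure M (\<Union>y\<in>Y. A \<inter> cball y (\<rho> * r))" by simp
  also have "\<dots> \<le> (\<Sum>y\<in>Y. measure M (A \<inter> cball y (\<rho> * r)))"
    using A Y(1) by (intro finite_measure_subadditive_finite) auto
  also have "\<dots> \<le> (\<Sum>y\<in>Y. \<tau> / (16 * b / a) * (\<rho> * r))"
    using small Y(2) by (intro sum_mono) (auto intro: less_imp_le)
  also have "\<dots> = real (card Y) * (\<tau> / (16 * b / a) * (\<rho> * r))" by simp
  also have "\<dots> \<le> ?B * (\<tau> / (16 * b / a) * (\<rho> * r))"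
    using card a b assms by (intro mult_right_mono) auto
  also have "\<dots> = \<tau> * r / 4" using a b assms by (simp add: field_simps)
  also have "\<dots> < \<tau> * r / 2" using assms by simp
  finally show False using mass by simp
qed

text \<open>
  The points are chosen greedily. The \<open>m\<close> balls of radius \<open>4 * (\<rho> * r)\<close> around earlier points have
  total mass at most \<open>m * b * 4 * (\<rho> * r) = \<tau> * r / 2\<close>, by upper regularity and the value of \<open>\<rho>\<close>. So
  half of the mass is left outside of them, and it contains another dense point.
\<close>

lemma separated_dense_points:
  assumes K: "K \<in> sets borel" "K \<subseteq> E" and x: "x \<in> K"
    and r: "0 < r" "2 * r < D" and \<tau>: "0 < \<tau>" and m: "0 < m"
    and mass: "\<tau> * r \<le> measure M (K \<inter> cball x r)"
  defines "\<rho> \<equiv> \<tau> / (8 * b * real m)"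
  shows "\<exists>c. (\<forall>j<m. c j \<in> K \<and> \<tau> / (16 * b / a) * (\<rho> * r) \<le> measure M (K \<inter> cball (c j) (\<rho> * r))
      \<and> dist x (c j) \<le> r) \<and> (\<forall>i<m. \<forall>j<m. i \<noteq> j \<longrightarrow> 4 * (\<rho> * r) \<le> dist (c i) (c j))"
proof -
  have "\<tau> * r \<le> b * r"
  proof -
    have "measure M (K \<inter> cball x r) \<le> measure M (cball x r)" by (rule finite_measure_mono) auto
    also have "\<dots> \<le> b * r" using x K r by (intro upper) auto
    finally show ?thesis using mass by simp
  qed
  then have \<tau>b: "\<tau> \<le> b" using r by simp
  have \<rho>: "0 < \<rho>" unfolding \<rho>_def using \<tau> b m by simp
  have "\<rho> \<le> 1 / 8"
  proof -
    have "\<tau> * 1 \<le> b * real m" using \<tau>b \<tau> b m by (intro mult_mono) auto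
    then show ?thesis unfolding \<rho>_def using b m by (simp add: field_simps)
  qed
  then have \<rho>r: "4 * (\<rho> * r) < D" using r mult_right_mono[of \<rho> "1/8" r] by linarith
  have "\<exists>c. (\<forall>j<n. c j \<in> K \<and> \<tau> / (16 * b / a) * (\<rho> * r) \<le> measure M (K \<inter> cball (c j) (\<rho> * r))
      \<and> dist x (c j) \<le> r) \<and> (\<forall>i<n. \<forall>j<n. i \<noteq> j \<longrightarrow> 4 * (\<rho> * r) \<le> dist (c i) (c j))"
    if "n \<le> m" for n
    using that
  proof (induction n)
    case (Suc n)
    then obtain c where c: "\<And>j. j < n \<Longrightarrow> c j \<in> K"
      "\<And>j. j < n \<Longrightarrow> \<tau> / (16 * b / a) * (\<rho> * r) \<le> measure M (K \<inter> cball (c j) (\<rho> * r))"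
      "\<And>j. j < n \<Longrightarrow> dist x (c j) \<le> r"
      "\<And>i j. i < n \<Longrightarrow> j < n \<Longrightarrow> i \<noteq> j \<Longrightarrow> 4 * (\<rho> * r) \<le> dist (c i) (c j)" by auto
    define R where "R = (\<Union>i<n. cball (c i) (4 * (\<rho> * r)))"
    define A where "A = K \<inter> cball x r - R"
    have R: "R \<in> sets borel" unfolding R_def by auto
    have A: "A \<in> sets borel" unfolding A_def using K R by auto
    have "measure M R \<le> (\<Sum>i<n. measure M (cball (c i) (4 * (\<rho> * r))))"
      unfolding R_def by (rule finite_measure_subadditive_finite) auto
    also have "\<dots> \<le> (\<Sum>i<n. b * (4 * (\<rho> * r)))"
      using c(1) K \<rho> r \<rho>r by (intro sum_mono upper) auto
    also have "\<dots> = real n * (b * (4 * (\<rho> * r)))" by simp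
    also have "\<dots> \<le> real m * (b * (4 * (\<rho> * r)))"
      using Suc.prems b \<rho> r by (intro mult_right_mono) auto
    also have "\<dots> = \<tau> * r / 2" unfolding \<rho>_def using b m by (simp add: field_simps)
    finally have "measure M R \<le> \<tau> * r / 2" .
    moreover have "measure M (K \<inter> cball x r) \<le> measure M A + measure M R"
    proof -
      have "measure M (K \<inter> cball x r) \<le> measure M (A \<union> R)"
        by (rule finite_measure_mono) (force simp: A_def, use A R in simp)
      also have "\<dots> \<le> measure M A + measure M R" using A R by (intro measure_Un_le) auto
      finally show ?thesis .
    qed
    ultimately have A_mass: "\<tau> * r / 2 \<le> measure M A" using mass by simp
    have "A \<subseteq> E \<inter> cball x r" using K by (auto simp: A_def)
    then obtain z where z: "z \<in> A" "\<tau> / (16 * b / a) * (\<rho> * r) \<le> measure M (A \<inter> cball z (\<rho> * r))"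
      using dense_point_exists[of x r \<rho> \<tau> A] x K r \<rho> \<open>\<rho> \<le> 1 / 8\<close> \<tau> A A_mass by auto
    have "measure M (A \<inter> cball z (\<rho> * r)) \<le> measure M (K \<inter> cball z (\<rho> * r))"
      using K by (intro finite_measure_mono) (auto simp: A_def)
    with z have dense: "\<tau> / (16 * b / a) * (\<rho> * r) \<le> measure M (K \<inter> cball z (\<rho> * r))" by simp
    have zK: "z \<in> K" "dist x z \<le> r" using z by (auto simp: A_def)
    have far: "4 * (\<rho> * r) \<le> dist (c i) z" if "i < n" for i
    proof -
      have "z \<notin> cball (c i) (4 * (\<rho> * r))" using z(1) that unfolding A_def R_def by blast
      then show ?thesis by simp
    qed
    show ?case
      by (rule exI[of _ "c(n := z)"])
        (use c dense zK far in \<open>auto simp: less_Suc_eq dist_commute\<close>)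
  qed simp
  then show ?thesis by blast
qed

lemma dense_ball_exists:
  assumes K: "compact K" and pos: "0 < measure M K" and r: "0 < r"
  shows "\<exists>x\<in>K. 0 < measure M (K \<inter> cball x r)"
proof (rule ccontr)
  assume asm: "\<not> ?thesis"
  have null: "measure M (K \<inter> cball x r) = 0" if "x \<in> K" for x
    using asm that measure_nonneg[of M "K \<inter> cball x r"] by (metis order_le_less)
  obtain Y where Y: "finite Y" "Y \<subseteq> K" "K \<subseteq> (\<Union>y\<in>Y. ball y r)"
    by (rule compactE_image[OF K, of K "\<lambda>x. ball x r"]) (use r in auto)
  have K_sets: "K \<in> sets borel" using K by (rule borel_compact)
  have "K = (\<Union>y\<in>Y. K \<inter> cball y r)" using Y(3) by force
  then have "measure M K = measure M (\<Union>y\<in>Y. K \<inter> cball y r)" by simp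
  also have "\<dots> \<le> (\<Sum>y\<in>Y. measure M (K \<inter> cball y r))"
    using K_sets Y(1) by (intro finite_measure_subadditive_finite) auto
  also have "\<dots> = 0" using null Y(2) by (intro sum.neutral) auto
  finally show False using pos by simp
qed

end

text \<open>
  A centre \<open>x\<close> of generation \<open>k\<close> is good if \<open>K\<close> has mass at least \<open>\<tau> / \<Lambda> ^ k * r k\<close> in the ball of
  radius \<open>r k\<close> around \<open>x\<close>, where \<open>\<tau>\<close> is the density at the root. The constant \<open>\<Lambda> = 16 * b / a\<close> is the
  loss of density per generation, and \<open>\<sigma> = \<tau> / (8 * b)\<close> comes from the radius of the children in
  \<open>separated_dense_points\<close>. The numerical bounds on both constants follow from \<open>a \<le> b\<close> and \<open>\<tau> \<le> b\<close>.
\<close>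

lemma (in ahlfors_measure) dense_point_tree:
  assumes K: "compact K" "K \<subseteq> E" "0 < measure M K" and "0 < D"
  obtains r :: "nat \<Rightarrow> real" and \<sigma> \<Lambda> :: real and good :: "nat \<Rightarrow> 'a \<Rightarrow> bool" and x0 :: 'a
  where "0 < \<sigma>" "\<sigma> \<le> 1 / 8" "16 \<le> \<Lambda>" "0 < r 0" "\<And>k. r (Suc k) = \<sigma> / (\<Lambda> ^ k * real (branching k)) * r k"
    "good 0 x0" "\<And>k x. good k x \<Longrightarrow> x \<in> K"
    "\<And>k x. good k x \<Longrightarrow> \<exists>c. (\<forall>j<branching k. good (Suc k) (c j) \<and> dist x (c j) \<le> r k) \<and>
        (\<forall>i<branching k. \<forall>j<branching k. i \<noteq> j \<longrightarrow> 4 * r (Suc k) \<le> dist (c i) (c j))"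
proof -
  define r0 where "r0 = D / 3"
  have r0: "0 < r0" "2 * r0 < D" using \<open>0 < D\<close> by (auto simp: r0_def)
  obtain x0 where x0: "x0 \<in> K" "0 < measure M (K \<inter> cball x0 r0)"
    using dense_ball_exists[OF K(1,3) r0(1)] by blast
  define \<tau> where "\<tau> = measure M (K \<inter> cball x0 r0) / r0"
  have \<tau>: "0 < \<tau>" "\<tau> * r0 = measure M (K \<inter> cball x0 r0)" using x0 r0 by (auto simp: \<tau>_def)
  have x0E: "x0 \<in> E" using x0 K by blast
  define \<sigma> where "\<sigma> = \<tau> / (8 * b)"
  define \<Lambda> where "\<Lambda> = 16 * b / a"
  have "\<tau> * r0 \<le> measure M (cball x0 r0)" unfolding \<tau>(2) by (rule finite_measure_mono) auto
  also have "\<dots> \<le> b * r0" using x0E r0 by (intro upper) auto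
  finally have "\<tau> \<le> b" using r0 by simp
  then have \<sigma>: "0 < \<sigma>" "\<sigma> \<le> 1 / 8" using \<tau> b by (auto simp: \<sigma>_def)
  have "a * r0 \<le> b * r0" using lower[OF x0E, of r0] upper[OF x0E, of r0] r0 by linarith
  then have \<Lambda>: "16 \<le> \<Lambda>" using r0 a by (simp add: \<Lambda>_def field_simps)
  define r where "r = rec_nat r0 (\<lambda>k x. \<sigma> / (\<Lambda> ^ k * branching k) * x)"
  have rS: "r (Suc k) = \<sigma> / (\<Lambda> ^ k * branching k) * r k" for k by (simp add: r_def)
  have r00: "r 0 = r0" by (simp add: r_def)
  have r_pos: "0 < r k" and r_dec: "r (Suc k) \<le> r k / 8" for k
    using tree_scales(1,2)[of \<sigma> \<Lambda> r] \<sigma> \<Lambda> r0 rS by (auto simp: r00)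
  have r_small: "2 * r k < D" for k
  proof (induction k)
    case (Suc k) then show ?case using r_dec[of k] r_pos[of k] by linarith
  qed (use r0 r00 in simp)
  define good where "good k x \<longleftrightarrow> x \<in> K \<and> \<tau> / \<Lambda> ^ k * r k \<le> measure M (K \<inter> cball x (r k))" for k x
  show thesis
  proof (rule that[of \<sigma> \<Lambda> r good x0])
    show "good 0 x0" using x0 \<tau> by (simp add: good_def r00)
    show "\<exists>c. (\<forall>j<branching k. good (Suc k) (c j) \<and> dist x (c j) \<le> r k) \<and>
        (\<forall>i<branching k. \<forall>j<branching k. i \<noteq> j \<longrightarrow> 4 * r (Suc k) \<le> dist (c i) (c j))" if "good k x" for k x
    proof -
      have step: "\<tau> / \<Lambda> ^ k / (8 * b * real (branching k)) * r k = r (Suc k)"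
        by (simp add: rS \<sigma>_def field_simps)
      have rate: "\<tau> / \<Lambda> ^ k / (16 * b / a) = \<tau> / \<Lambda> ^ Suc k"
        unfolding \<Lambda>_def[symmetric] by simp
      have "\<exists>c. (\<forall>j<branching k. c j \<in> K \<and> \<tau> / \<Lambda> ^ Suc k * r (Suc k) \<le> measure M (K \<inter> cball (c j) (r (Suc k)))
          \<and> dist x (c j) \<le> r k) \<and> (\<forall>i<branching k. \<forall>j<branching k. i \<noteq> j \<longrightarrow> 4 * r (Suc k) \<le> dist (c i) (c j))"
        using separated_dense_points[of K x "r k" "\<tau> / \<Lambda> ^ k" "branching k", unfolded step rate]
          that K r_pos[of k] r_small[of k] \<tau> \<Lambda> branching_pos by (simp add: good_def borel_compact)
      then show ?thesis unfolding good_def by blast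
    qed
  qed (use \<sigma> \<Lambda> r0 r00 rS in \<open>auto simp: good_def\<close>)
qed

section \<open>A curve meeting the set in dimension one\<close>

text \<open>
  One tree serves the curve and all exponents \<open>s < 1\<close>: the curve passes through all its limit
  points, and the limit set has positive \<open>s\<close>-dimensional measure.
\<close>

theorem lipschitz_image_meeting_compact_set:
  fixes E :: "(real ^ 'n) set"
  assumes "ahlfors_measure M E a b D" and K: "compact K" "K \<subseteq> E" "0 < measure M K" and "0 < D"
  shows "\<exists>(g :: real \<Rightarrow> real ^ 'n) L. L-lipschitz_on {0..1} g \<and>
    (\<forall>s. 0 \<le> s \<and> s < 1 \<longrightarrow> 0 < hausdorff_measure s (K \<inter> g ` {0..1}))"
proof -
  interpret ahlfors_measure M E a b D by fact
  define m where "m = branching"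
  define N where "N = node_count m"
  obtain r \<sigma> \<Lambda> good x0 where
    \<sigma>: "0 < \<sigma>" "\<sigma> \<le> 1 / 8" "16 \<le> \<Lambda>" and r: "0 < r 0" "\<And>k. r (Suc k) = \<sigma> / (\<Lambda> ^ k * real (m k)) * r k"
    and good: "good 0 x0" "\<And>k x. good k x \<Longrightarrow> x \<in> K"
    and child: "\<And>k x. good k x \<Longrightarrow> \<exists>c. (\<forall>j<m k. good (Suc k) (c j) \<and> dist x (c j) \<le> r k) \<and>
        (\<forall>i<m k. \<forall>j<m k. i \<noteq> j \<longrightarrow> 4 * r (Suc k) \<le> dist (c i) (c j))"
    by (rule dense_point_tree[OF K \<open>0 < D\<close>, folded m_def]) (rule that; assumption)
  note scales = tree_scales[OF \<sigma> r(1) r(2)[unfolded m_def], folded m_def, folded N_def]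
  obtain p where pK: "p ` {0..<1} \<subseteq> K"
    and p: "\<And>t u k. t \<in> {0..<1} \<Longrightarrow> u \<in> {0..<1} \<Longrightarrow> \<lfloor>real (N k) * t\<rfloor> = \<lfloor>real (N k) * u\<rfloor> \<Longrightarrow> \<lfloor>real (N (Suc k)) * t\<rfloor> \<noteq> \<lfloor>real (N (Suc k)) * u\<rfloor> \<Longrightarrow>
       r (Suc k) \<le> dist (p t) (p u) \<and> dist (p t) (p u) \<le> 4 * r k"
    using separated_tree_limit[of K good x0 m r, folded N_def]
      good child scales(1,2) compact_imp_closed[OF K(1)] by (auto simp: m_def branching_def)
  have N0: "N 0 = 1" by (simp add: N_def node_count_def)
  have N_large: "k \<le> N k" for k
  proof (induction k)
    case (Suc k)
    show ?case
    proof (cases "k = 0")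
      case False
      then have "2 ^ 1 \<le> m k" unfolding m_def branching_def by (intro power_increasing) auto
      then have "k * 2 \<le> N k * m k" using Suc.IH by (intro mult_mono) auto
      then show ?thesis using False by (simp add: N_def node_count_def)
    qed (simp add: N_def node_count_def m_def branching_def)
  qed simp
  have "dist (p t) (p u) \<le> 4 * r k" if "t \<in> {0..<1}" "u \<in> {0..<1}"
    "\<lfloor>real (N k) * t\<rfloor> = \<lfloor>real (N k) * u\<rfloor>" "\<lfloor>real (N (Suc k)) * t\<rfloor> \<noteq> \<lfloor>real (N (Suc k)) * u\<rfloor>" for t u k
    using p[OF that] by simp
  then have "\<exists>(g :: real \<Rightarrow> real ^ 'n) L. L-lipschitz_on {0..1} g \<and> p ` {0..<1} \<subseteq> g ` {0..1}"
    by (rule lipschitz_image_through_tree[where p = p and N = N and r = r, OF N0 N_large scales(1,3)])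
  then obtain g :: "real \<Rightarrow> real ^ 'n" and L where g: "L-lipschitz_on {0..1} g" "p ` {0..<1} \<subseteq> g ` {0..1}"
    by (elim exE conjE)
  have "0 < hausdorff_measure s (K \<inter> g ` {0..1})" if s: "0 \<le> s" "s < 1" for s
  proof -
    obtain C where C: "0 < C" "\<And>k. 1 / N k \<le> C * r (Suc k) powr s" using scales(4)[OF s] by blast
    have lt: "\<bar>t - u\<bar> \<le> C * dist (p t) (p u) powr s"
      if tu: "t \<in> {0..<1}" "u \<in> {0..<1}" "t < u" for t u
    proof -
      obtain k where k: "\<lfloor>real (N k) * t\<rfloor> = \<lfloor>real (N k) * u\<rfloor>" "\<lfloor>real (N (Suc k)) * t\<rfloor> \<noteq> \<lfloor>real (N (Suc k)) * u\<rfloor>"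
        using branching_level[of N t u] N0 N_large tu by auto
      \<comment> \<open>Addresses with a common ball of generation \<open>k\<close> differ by at most \<open>1 / N k\<close>.\<close>
      have "N k * u - N k * t \<le> 1" using k(1) by linarith
      moreover have "0 < N k" by (simp add: N_def node_count_def m_def branching_def prod_pos)
      ultimately have "\<bar>t - u\<bar> \<le> 1 / N k" using tu by (simp add: field_simps)
      also have "\<dots> \<le> C * r (Suc k) powr s" by (rule C)
      also have "\<dots> \<le> C * dist (p t) (p u) powr s"
        using p[OF tu(1,2) k] C s scales(1)[of "Suc k"] by (intro mult_left_mono powr_mono2) auto
      finally show ?thesis .
    qed
    show ?thesis
    proof (rule hausdorff_measure_pos_if_holder_inverse[OF s(1) C(1)])
      show "p ` {0..<1} \<subseteq> K \<inter> g ` {0..1}" using pK g by blast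
      show "\<bar>t - u\<bar> \<le> C * dist (p t) (p u) powr s" if "t \<in> {0..<1}" "u \<in> {0..<1}" for t u
        using lt[of t u] lt[of u t] that C
        by (cases t u rule: linorder_cases) (auto simp: dist_commute abs_minus_commute)
    qed
  qed
  with g(1) show ?thesis by blast
qed

theorem proposition2p8:
  fixes E :: "(real^2) set"
  assumes "bounded E" and "one_set E" and "ahlfors_regular E"
  shows "\<exists>I. lipschitz_image I \<and> hausdorff_dim (E \<inter> I) = 1"
proof -
  have meas: "hausdorff_measurable 1 E" and dim: "hausdorff_dim E = 1"
    and pos: "0 < hausdorff_measure 1 E" and fin: "hausdorff_measure 1 E < \<infinity>"
    using assms(2) by (auto simp: one_set_def)
  obtain a b where a: "0 < a" and b: "0 < b"
    and reg: "\<And>x r. x \<in> E \<Longrightarrow> 0 < r \<Longrightarrow> r < diameter E \<Longrightarrow>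
        ennreal (a * r) \<le> hausdorff_measure 1 (E \<inter> cball x r) \<and>
        hausdorff_measure 1 (E \<inter> cball x r) \<le> ennreal (b * r)"
    using assms(1,3) unfolding ahlfors_regular_def by blast
  \<comment> \<open>A set of diameter \<open>0\<close> covers itself at no cost.\<close>
  have D: "0 < diameter E"
  proof (rule ccontr)
    assume "\<not> 0 < diameter E"
    then have D0: "diameter E = 0" using diameter_ge_0[OF assms(1)] by simp
    have "hausdorff_content 1 \<delta> E \<le> 0" if "0 < \<delta>" for \<delta>
    proof -
      let ?U = "\<lambda>i::nat. if i = 0 then E else {}"
      have "?U \<in> delta_covers \<delta> E"
        using assms(1) D0 that by (auto simp: delta_covers_def split: if_splits)
      then have "hausdorff_content 1 \<delta> E \<le> (\<Sum>i. diam_pow 1 (?U i))"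
        unfolding hausdorff_content_def by (rule INF_lower)
      also have "(\<lambda>i. diam_pow 1 (?U i)) = (\<lambda>i. 0)" using D0 by (auto simp: diam_pow_def)
      finally show ?thesis by simp
    qed
    then have "hausdorff_measure 1 E \<le> 0" unfolding hausdorff_measure_def by (intro SUP_least) auto
    with pos show False by simp
  qed
  define M where "M = hausdorff_on 1 E"
  have em: "emeasure M A = hausdorff_measure 1 (E \<inter> A)" if "A \<in> sets borel" for A
    unfolding M_def using meas that by (rule emeasure_hausdorff_on)
  have em_fin: "emeasure M A < \<infinity>" if "A \<in> sets borel" for A
    unfolding em[OF that] using fin hausdorff_measure_mono[of "E \<inter> A" E 1] by (auto intro: le_less_trans)
  have sets: "sets M = sets borel" by (simp add: M_def sets_hausdorff_on)
  have finite: "finite_measure M"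
    using em_fin[of UNIV] sets_eq_imp_space_eq[OF sets] by (intro finite_measureI) simp
  interpret M: ahlfors_measure M E a b "diameter E"
  proof (intro ahlfors_measure.intro ahlfors_measure_axioms.intro)
    show "sets M = sets borel" by (rule sets)
    fix x :: "real ^ 2" and r :: real assume x: "x \<in> E" "0 < r" "r < diameter E"
    have eq: "ennreal (measure M (cball x r)) = hausdorff_measure 1 (E \<inter> cball x r)"
      using em_fin[of "cball x r"] em[of "cball x r"] finite_measure.emeasure_eq_measure[OF finite] by simp
    show "a * r \<le> measure M (cball x r)" "measure M (cball x r) \<le> b * r"
      using reg[OF x] b x by (simp_all add: ennreal_le_iff flip: eq)
  qed (rule finite a b)+
  obtain K where K: "compact K" "K \<subseteq> E" "0 < hausdorff_measure 1 K"
    using compact_subset_of_positive_measure[OF meas pos fin] .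
  have "0 < emeasure M K" using em[of K] K by (simp add: borel_compact Int_absorb1)
  then have "0 < measure M K"
    using em_fin[of K] K by (simp add: measure_def enn2real_positive_iff borel_compact)
  then obtain g :: "real \<Rightarrow> real ^ 2" and L where g: "L-lipschitz_on {0..1} g"
    "\<And>s. 0 \<le> s \<Longrightarrow> s < 1 \<Longrightarrow> 0 < hausdorff_measure s (K \<inter> g ` {0..1})"
    using lipschitz_image_meeting_compact_set[OF M.ahlfors_measure_axioms K(1,2) _ D] by blast
  let ?I = "g ` {0..1}"
  have "1 \<le> hausdorff_dim (K \<inter> ?I)" by (rule hausdorff_dim_ge_one) (rule g(2))
  also have "\<dots> \<le> hausdorff_dim (E \<inter> ?I)" using K(2) by (intro hausdorff_dim_mono) auto
  finally have "1 \<le> hausdorff_dim (E \<inter> ?I)" .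
  moreover have "hausdorff_dim (E \<inter> ?I) \<le> 1" using hausdorff_dim_mono[of "E \<inter> ?I" E] dim by simp
  moreover have "lipschitz_image ?I" unfolding lipschitz_image_def using g(1) by blast
  ultimately show ?thesis using antisym by blast
qed

end
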